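(* Fix $k\in\mathbb{N}$, positive constants $b_0,b_1,b_2,\lambda_0,\lambda_1$ and $\mu\in(0,1)$. There exists a constant $C>0$ depending only on $b_0,b_1,b_2,\lambda_0,\lambda_1,\mu$ (and the fixed $k$) such that the following holds. Let $T\geq 10$, $\ell<r$, $a^\pm\in\mathbb{R}^k$, let $g:[\ell,r]\to\mathbb{R}$ be Lipschitz with $g(\ell)=g(r)=0$, and let $P\subset(\ell,r)$ be finite. Suppose that $r-\ell\leq b_0T$, $|P|\leq b_0T$, $|g(x)-g(y)|\leq b_1T|x-y|$ for all $x,y\in[\ell,r]$, $a^\pm_j-a^\pm_{j+1}\geq\lambda_0T^{1/2}$ for all $j\in\{1,\dots,k-1\}$, $a^-_k-g(\ell)\geq\lambda_1T$, $a^+_k-g(r)\geq\lambda_1T$, $a^-_1-g(\ell)\leq b_2T^2$ and $a^+_1-g(r)\leq b_2T^2$. Then $\mathbb{P}_{\mathcal{L}}(\mathsf{H})\geq C^{-1}e^{-CT^{5/2}}$.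
   Context: For $\ell<r$ and $a^-=(a^-_1,\dots,a^-_k)$, $a^+=(a^+_1,\dots,a^+_k)\in\mathbb{R}^k$, $\mathbb{P}_{\mathrm{free}}$ denotes the law of $k$ independent Brownian bridges (diffusion parameter one) $\mathcal{L}=(\mathcal{L}_1,\dots,\mathcal{L}_k)$ on $[\ell,r]$ with $\mathcal{L}_j(\ell)=a^-_j$ and $\mathcal{L}_j(r)=a^+_j$. Given $g$ and a finite $P\subset(\ell,r)$, let $W(\mathcal{L})=1$ if $\mathcal{L}_j(p)>g(p)$ for all $p\in P$ and all $j\in\{1,\dots,k\}$, and $W(\mathcal{L})=0$ otherwise; $\mathbb{P}_{\mathcal{L}}$ is the probability measure with $\frac{d\mathbb{P}_{\mathcal{L}}}{d\mathbb{P}_{\mathrm{free}}}=W/\mathbb{E}_{\mathrm{free}}[W]$ (free bridges conditioned to be above $g$ at the points of $P$). For $\mu\in(0,1)$, $\mathsf{H}$ is the event that $\mathcal{L}_j(p)-\mathcal{L}_{j+1}(p)\geq\mu\lambda_0T^{1/2}$ for all $p\in P$ and $j\in\{1,\dots,k-1\}$, and $\mathcal{L}_k(p)-g(p)\geq\mu\lambda_1T$ for all $p\in P$. *)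

theory Defs
  imports "HOL-Analysis.Analysis"
begin

definition heat_kernel :: "real \<Rightarrow> real \<Rightarrow> real" where
  "heat_kernel t x = exp (- (x^2) / (2 * t)) / sqrt (2 * pi * t)"

definition bridge_fdd_density ::
  "real \<Rightarrow> real \<Rightarrow> real \<Rightarrow> real \<Rightarrow> real set \<Rightarrow> (real \<Rightarrow> real) \<Rightarrow> real" where
  "bridge_fdd_density l r a b P y =
     (let ps = [l] @ sorted_list_of_set P @ [r];
          vs = [a] @ map y (sorted_list_of_set P) @ [b]
      in (\<Prod>i<length ps - 1. heat_kernel (ps!(i+1) - ps!i) (vs!(i+1) - vs!i))
         / heat_kernel (r - l) (b - a))"

text \<open>Joint density of the values (L_j(p))_{j in {1..k}, p in P} of k independent
  Brownian bridges L_j from am j (at l) to ap j (at r).\<close>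
definition free_density ::
  "nat \<Rightarrow> real \<Rightarrow> real \<Rightarrow> (nat \<Rightarrow> real) \<Rightarrow> (nat \<Rightarrow> real) \<Rightarrow> real set
     \<Rightarrow> (nat \<times> real \<Rightarrow> real) \<Rightarrow> real" where
  "free_density k l r am ap P x =
     (\<Prod>j\<in>{1..k}. bridge_fdd_density l r (am j) (ap j) P (\<lambda>p. x (j, p)))"

definition grid_space :: "nat \<Rightarrow> real set \<Rightarrow> (nat \<times> real \<Rightarrow> real) measure" where
  "grid_space k P = PiM ({1..k} \<times> P) (\<lambda>_. lborel)"

definition free_expectation ::
  "nat \<Rightarrow> real \<Rightarrow> real \<Rightarrow> (nat \<Rightarrow> real) \<Rightarrow> (nat \<Rightarrow> real) \<Rightarrow> real set
     \<Rightarrow> ((nat \<times> real \<Rightarrow> real) \<Rightarrow> real) \<Rightarrow> real" where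
  "free_expectation k l r am ap P F =
     integral\<^sup>L (grid_space k P) (\<lambda>x. free_density k l r am ap P x * F x)"

definition above_event ::
  "nat \<Rightarrow> (real \<Rightarrow> real) \<Rightarrow> real set \<Rightarrow> (nat \<times> real \<Rightarrow> real) \<Rightarrow> bool" where
  "above_event k g P x \<longleftrightarrow> (\<forall>j\<in>{1..k}. \<forall>p\<in>P. x (j, p) > g p)"

definition H_event ::
  "nat \<Rightarrow> real \<Rightarrow> real \<Rightarrow> real \<Rightarrow> real \<Rightarrow> (real \<Rightarrow> real) \<Rightarrow> real set
     \<Rightarrow> (nat \<times> real \<Rightarrow> real) \<Rightarrow> bool" where
  "H_event k \<mu> lam0 lam1 T g P x \<longleftrightarrow>
     (\<forall>p\<in>P. (\<forall>j\<in>{1..<k}. x (j, p) - x (j+1, p) \<ge> \<mu> * lam0 * T powr (1/2))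
            \<and> x (k, p) - g p \<ge> \<mu> * lam1 * T)"

definition cond_prob_H ::
  "nat \<Rightarrow> real \<Rightarrow> real \<Rightarrow> (nat \<Rightarrow> real) \<Rightarrow> (nat \<Rightarrow> real) \<Rightarrow> (real \<Rightarrow> real) \<Rightarrow> real set
     \<Rightarrow> real \<Rightarrow> real \<Rightarrow> real \<Rightarrow> real \<Rightarrow> real" where
  "cond_prob_H k l r am ap g P \<mu> lam0 lam1 T =
     free_expectation k l r am ap P
        (\<lambda>x. indicator {x. above_event k g P x \<and> H_event k \<mu> lam0 lam1 T g P x} x)
     / free_expectation k l r am ap P (\<lambda>x. indicator {x. above_event k g P x} x)"

end

theory Submission
  imports Defs "HOL-Probability.Distributions"
begin

text \<open>The curves are independent Gaussian vectors whose log-density is minus the Dirichlet energy of the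
  piecewise linear path through the grid values. Let \<open>f j\<close> be the least concave majorant of \<open>g\<close> on \<open>P\<close>
  with the boundary values of curve \<open>j\<close>. It bends only where it touches \<open>g\<close>, so the linear term in the
  expansion of the energy around \<open>f j\<close> is nonnegative on paths above \<open>g\<close>; hence the normalising
  constant is at most \<open>exp (- energy of f)\<close> times the mass of the centred bridges.
  Recentring at \<open>f j\<close> plus \<open>k + 1 - j\<close> copies of a tent of height \<open>O(T)\<close> and slope \<open>O(T)\<close> separates
  the curves and changes the energy by \<open>O(T\<^sup>2)\<close> only, because \<open>f j\<close> has total bending \<open>O(T)\<close>.
  A centred configuration of energy at most \<open>\<kappa>\<close> deviates by at most \<open>O(T powr (1/2))\<close>, and by scaling
  such configurations carry at least a proportion \<open>exp (- O(T\<^sup>2))\<close> of the mass.\<close>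

subsection \<open>Concave sequences and the Dirichlet form\<close>

definition slope :: "(nat \<Rightarrow> real) \<Rightarrow> (nat \<Rightarrow> real) \<Rightarrow> nat \<Rightarrow> real" where
  "slope p u i = (u (Suc i) - u i) / (p (Suc i) - p i)"

text \<open>The integral of the product of the derivatives of the piecewise linear interpolations of
  \<open>u\<close> and \<open>v\<close> at the nodes \<open>p 0\<close>, ...,
  \<open>p (Suc n)\<close>; \<open>n\<close> counts interior nodes, so there are
  \<open>n + 1\<close> increments.\<close>

definition dirichlet :: "(nat \<Rightarrow> real) \<Rightarrow> nat \<Rightarrow> (nat \<Rightarrow> real) \<Rightarrow> (nat \<Rightarrow> real) \<Rightarrow> real" where
  "dirichlet p n u v = (\<Sum>i\<le>n. slope p u i * (v (Suc i) - v i))"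

definition concave_seq :: "(nat \<Rightarrow> real) \<Rightarrow> nat \<Rightarrow> (nat \<Rightarrow> real) \<Rightarrow> bool" where
  "concave_seq p n u \<longleftrightarrow> (\<forall>i<n. slope p u (Suc i) \<le> slope p u i)"

text \<open>Height at \<open>p (Suc i)\<close> of the segment joining the two neighbouring points,
  written as a weighted average so that monotonicity in \<open>u\<close> is visible.\<close>

definition chord :: "(nat \<Rightarrow> real) \<Rightarrow> (nat \<Rightarrow> real) \<Rightarrow> nat \<Rightarrow> real" where
  "chord p u i = (u i * (p (Suc (Suc i)) - p (Suc i)) + u (Suc (Suc i)) * (p (Suc i) - p i))
     / (p (Suc (Suc i)) - p i)"

definition grid_seq :: "(nat \<Rightarrow> real) \<Rightarrow> nat \<Rightarrow> bool" where
  "grid_seq p n \<longleftrightarrow> (\<forall>i\<le>n. p i < p (Suc i))"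

lemma dirichlet_add_left:
  "dirichlet p n (\<lambda>i. u i + v i) w = dirichlet p n u w + dirichlet p n v w"
  by (simp add: dirichlet_def slope_def sum.distrib[symmetric] algebra_simps add_divide_distrib diff_divide_distrib)

lemma dirichlet_add_right:
  "dirichlet p n w (\<lambda>i. u i + v i) = dirichlet p n w u + dirichlet p n w v"
  by (simp add: dirichlet_def sum.distrib[symmetric] algebra_simps)

lemma dirichlet_commute: "dirichlet p n u v = dirichlet p n v u"
  by (simp add: dirichlet_def slope_def mult.commute)

lemma dirichlet_scale: "dirichlet p n (\<lambda>i. c * u i) (\<lambda>i. c * u i) = c\<^sup>2 * dirichlet p n u u"
  by (simp add: dirichlet_def slope_def sum_distrib_left power2_eq_square algebra_simps
      add_divide_distrib diff_divide_distrib)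

lemma dirichlet_scale_left: "dirichlet p n (\<lambda>i. c * u i) v = c * dirichlet p n u v"
  by (simp add: dirichlet_def slope_def sum_distrib_left algebra_simps
      add_divide_distrib diff_divide_distrib)

lemma dirichlet_scale_right: "dirichlet p n u (\<lambda>i. c * v i) = c * dirichlet p n u v"
  by (simp add: dirichlet_def sum_distrib_left algebra_simps)

lemma dirichlet_nonneg: "grid_seq p n \<Longrightarrow> 0 \<le> dirichlet p n u u"
  by (auto simp: dirichlet_def slope_def grid_seq_def intro!: sum_nonneg divide_nonneg_pos)

lemma dirichlet_square:
  "dirichlet p n (\<lambda>i. u i + v i) (\<lambda>i. u i + v i)
    = dirichlet p n u u + 2 * dirichlet p n u v + dirichlet p n v v"
  using dirichlet_commute[of p n u v] by (simp add: dirichlet_add_left dirichlet_add_right)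

text \<open>Summation by parts moves the difference from \<open>v\<close> to the slopes of
  \<open>u\<close>. The coefficients are the bends of \<open>u\<close>, nonnegative for concave
  \<open>u\<close> and zero where \<open>u\<close> is straight; both the sign argument and the size
  bound for the linear term rest on this.\<close>

lemma dirichlet_by_parts:
  assumes "v 0 = 0" "v (Suc n) = 0"
  shows "dirichlet p n u v = (\<Sum>i<n. (slope p u i - slope p u (Suc i)) * v (Suc i))"
proof -
  have "(\<Sum>i\<le>n. s i * (v (Suc i) - v i))
      = (\<Sum>i<n. (s i - s (Suc i)) * v (Suc i)) + s n * v (Suc n) - s 0 * v 0" for s
    by (induction n) (simp_all add: algebra_simps lessThan_Suc_atMost[symmetric])
  from this[of "slope p u"] show ?thesis using assms by (simp add: dirichlet_def)
qed

text \<open>Only the total bending matters: the nonnegative bends telescope to the difference of the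
  first and the last slope.\<close>

lemma dirichlet_bound:
  assumes "v 0 = 0" "v (Suc n) = 0" "concave_seq p n u" "\<And>i. i < n \<Longrightarrow> \<bar>v (Suc i)\<bar> \<le> m"
  shows "\<bar>dirichlet p n u v\<bar> \<le> (slope p u 0 - slope p u n) * m"
proof -
  have "\<bar>dirichlet p n u v\<bar> \<le> (\<Sum>i<n. \<bar>(slope p u i - slope p u (Suc i)) * v (Suc i)\<bar>)"
    unfolding dirichlet_by_parts[of v, OF assms(1,2)] by (rule sum_abs)
  also have "\<dots> \<le> (\<Sum>i<n. (slope p u i - slope p u (Suc i)) * m)"
    using assms(3,4) by (intro sum_mono) (auto simp: abs_mult concave_seq_def intro!: mult_mono)
  also have "\<dots> = (slope p u 0 - slope p u n) * m"
    by (simp add: sum_distrib_right[symmetric] sum_lessThan_telescope')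
  finally show ?thesis .
qed

text \<open>Cauchy-Schwarz for the increments, each divided and multiplied by the square root of its
  step length: a discrete Sobolev inequality that turns small energy into a uniform bound.\<close>

lemma square_le_dirichlet:
  assumes "grid_seq p n" "v 0 = 0" "m \<le> Suc n"
  shows "(v m)\<^sup>2 \<le> (p (Suc n) - p 0) * dirichlet p n v v"
proof -
  let ?d = "\<lambda>i. p (Suc i) - p i"
  have d: "?d i > 0" if "i \<le> n" for i using assms(1) that by (auto simp: grid_seq_def)
  have "v m = (\<Sum>i<m. v (Suc i) - v i)"
    using assms(2) by (simp add: sum_lessThan_telescope)
  also have "\<dots> = (\<Sum>i<m. ((v (Suc i) - v i) / sqrt (?d i)) * sqrt (?d i))"
    using d assms(3) by (intro sum.cong refl) (simp add: less_imp_neq[THEN not_sym])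
  finally have "(v m)\<^sup>2 \<le> (\<Sum>i<m. ((v (Suc i) - v i) / sqrt (?d i))\<^sup>2) * (\<Sum>i<m. (sqrt (?d i))\<^sup>2)"
    by (simp only: Cauchy_Schwarz_ineq_sum)
  also have "\<dots> = (\<Sum>i<m. slope p v i * (v (Suc i) - v i)) * (\<Sum>i<m. ?d i)"
    using d assms(3)
    by (intro arg_cong2[where f="(*)"] sum.cong refl)
       (auto simp: slope_def power_divide power2_eq_square less_imp_le real_sqrt_mult_self abs_of_pos)
  also have "\<dots> \<le> (\<Sum>i<Suc n. slope p v i * (v (Suc i) - v i)) * (\<Sum>i<Suc n. ?d i)"
    using d assms(3)
    by (intro mult_mono sum_mono2 sum_nonneg) (auto simp: slope_def less_imp_le intro!: divide_nonneg_pos)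
  also have "\<dots> = (p (Suc n) - p 0) * dirichlet p n v v"
    by (simp add: sum_lessThan_telescope dirichlet_def lessThan_Suc_atMost[symmetric] mult.commute
        del: sum.lessThan_Suc)
  finally show ?thesis .
qed

section \<open>Chords, slopes and supporting lines of concave sequences\<close>

lemma chord_le_iff:
  assumes "p i < p (Suc i)" "p (Suc i) < p (Suc (Suc i))"
  shows "chord p u i \<le> u (Suc i) \<longleftrightarrow> slope p u (Suc i) \<le> slope p u i"
  using assms by (auto simp: chord_def slope_def divide_simps) (auto simp: algebra_simps)

text \<open>The chord form of concavity passes to pointwise infima, because chords are monotone in
  the neighbouring values.\<close>

lemma concave_seq_chord:
  assumes "grid_seq p n"
  shows "concave_seq p n u \<longleftrightarrow> (\<forall>i<n. chord p u i \<le> u (Suc i))"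
  using assms by (auto simp: concave_seq_def grid_seq_def chord_le_iff)

lemma chord_mono:
  assumes "p i < p (Suc i)" "p (Suc i) < p (Suc (Suc i))" "u i \<le> v i" "u (Suc (Suc i)) \<le> v (Suc (Suc i))"
  shows "chord p u i \<le> chord p v i"
  unfolding chord_def using assms by (intro divide_right_mono add_mono mult_right_mono) auto

text \<open>A supporting line at an interior node separates the adjacent slopes: the right one is at
  most \<open>s\<close>, the left one at least \<open>s\<close>.\<close>

lemma concave_seq_touching_affine:
  assumes "grid_seq p n"
    and "\<And>i. i < n \<Longrightarrow> \<exists>c s. u (Suc i) = c + s * p (Suc i) \<and> u i \<le> c + s * p i
      \<and> u (Suc (Suc i)) \<le> c + s * p (Suc (Suc i))"
  shows "concave_seq p n u"
  unfolding concave_seq_def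
proof (intro allI impI)
  fix i assume i: "i < n"
  from assms(2)[OF i] obtain c s where *: "u (Suc i) = c + s * p (Suc i)" "u i \<le> c + s * p i"
      "u (Suc (Suc i)) \<le> c + s * p (Suc (Suc i))" by blast
  have d: "p i < p (Suc i)" "p (Suc i) < p (Suc (Suc i))" using assms(1) i by (auto simp: grid_seq_def)
  have "slope p u (Suc i) \<le> s" using * d by (simp add: slope_def divide_simps algebra_simps)
  also have "s \<le> slope p u i" using * d by (simp add: slope_def divide_simps algebra_simps)
  finally show "slope p u (Suc i) \<le> slope p u i" .
qed

lemma concave_seq_affine: "grid_seq p n \<Longrightarrow> concave_seq p n (\<lambda>i. c + s * p i)"
  by (rule concave_seq_touching_affine) auto

lemma concave_seq_add:
  assumes "concave_seq p n u" "concave_seq p n v"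
  shows "concave_seq p n (\<lambda>i. u i + v i)"
proof -
  have "slope p (\<lambda>i. u i + v i) i = slope p u i + slope p v i" for i
    by (simp add: slope_def add_divide_distrib[symmetric])
  then show ?thesis using assms by (auto simp: concave_seq_def intro!: add_mono)
qed

lemma concave_seq_slope_mono:
  assumes "concave_seq p n u" "i \<le> j" "j \<le> n"
  shows "slope p u j \<le> slope p u i"
  using assms(2,3)
proof (induction j rule: dec_induct)
  case (step m)
  then have "slope p u (Suc m) \<le> slope p u m" using assms(1) by (auto simp: concave_seq_def)
  with step show ?case by simp
qed simp

text \<open>The slope at \<open>m\<close> decides which end to compare with. If it is nonnegative,
  so are all earlier slopes, and \<open>u m\<close> is at least \<open>u 0\<close>; otherwise all
  later slopes are negative, and \<open>u m\<close> is at least \<open>u (Suc n)\<close>.\<close>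

lemma concave_seq_nonneg:
  assumes "grid_seq p n" "concave_seq p n u" "u 0 \<ge> 0" "u (Suc n) \<ge> 0" "m \<le> n"
  shows "u m \<ge> 0"
proof -
  have inc: "u (Suc i) - u i = slope p u i * (p (Suc i) - p i)" "p (Suc i) - p i > 0" if "i \<le> n" for i
    using assms(1) that by (auto simp: slope_def grid_seq_def)
  show ?thesis
  proof (cases "slope p u m \<ge> 0")
    case True
    have "0 \<le> (\<Sum>i<m. u (Suc i) - u i)"
    proof (intro sum_nonneg)
      fix i assume "i \<in> {..<m}"
      then have "i \<le> n" "0 \<le> slope p u i"
        using True concave_seq_slope_mono[OF assms(2), of i m] assms(5) by auto
      then show "0 \<le> u (Suc i) - u i" using inc[of i] by simp
    qed
    then show ?thesis using assms(3) by (simp add: sum_lessThan_telescope)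
  next
    case False
    have "(\<Sum>i\<in>{m..<Suc n}. u (Suc i) - u i) \<le> 0"
    proof (intro sum_nonpos)
      fix i assume "i \<in> {m..<Suc n}"
      then have "i \<le> n" "slope p u i \<le> 0"
        using False concave_seq_slope_mono[OF assms(2), of m i] by auto
      then show "u (Suc i) - u i \<le> 0" using inc by (simp add: mult_nonpos_nonneg less_imp_le)
    qed
    then show ?thesis using assms(4,5) by (simp add: sum_Suc_diff' del: sum.op_ivl_Suc)
  qed
qed

text \<open>Perron's method: the pointwise infimum of all concave majorants is concave, and it can only
  bend where it meets the obstacle.\<close>
lemma least_concave_majorant:
  fixes G :: "nat \<Rightarrow> real"
  assumes p: "grid_seq p n"
    and h0: "concave_seq p n h0" "\<And>i. i \<le> Suc n \<Longrightarrow> G i \<le> h0 i" "h0 0 = G 0"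
    and h1: "concave_seq p n h1" "\<And>i. i \<le> Suc n \<Longrightarrow> G i \<le> h1 i" "h1 (Suc n) = G (Suc n)"
  obtains u where "u 0 = G 0" "u (Suc n) = G (Suc n)" "concave_seq p n u"
    "\<And>i. i \<le> Suc n \<Longrightarrow> G i \<le> u i"
    "\<And>i. i < n \<Longrightarrow> slope p u (Suc i) < slope p u i \<Longrightarrow> u (Suc i) = G (Suc i)"
    "\<And>h i. concave_seq p n h \<Longrightarrow> (\<And>i. i \<le> Suc n \<Longrightarrow> G i \<le> h i) \<Longrightarrow> i \<le> Suc n \<Longrightarrow> u i \<le> h i"
proof -
  define S where "S = {h. concave_seq p n h \<and> (\<forall>i\<le>Suc n. G i \<le> h i)}"
  define u where "u i = Inf ((\<lambda>h. h i) ` S)" for i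
  have d: "p i < p (Suc i)" "p (Suc i) < p (Suc (Suc i))" if "i < n" for i
    using p that by (auto simp: grid_seq_def)
  have ne: "S \<noteq> {}" using h0 by (auto simp: S_def)
  have lo: "u i \<le> h i" if "h \<in> S" "i \<le> Suc n" for h i
    unfolding u_def using that by (intro cInf_lower) (auto simp: S_def intro!: bdd_belowI[of _ "G i"])
  have gr: "c \<le> u i" if "\<And>h. h \<in> S \<Longrightarrow> c \<le> h i" for c i
    unfolding u_def using ne that by (intro cInf_greatest) auto
  have G: "G i \<le> u i" if "i \<le> Suc n" for i
    using that by (intro gr) (auto simp: S_def)
  have conc: "chord p u i \<le> u (Suc i)" if i: "i < n" for i
  proof (rule gr)
    fix h assume h: "h \<in> S"
    have "chord p u i \<le> chord p h i" using d[OF i] lo[OF h] i by (intro chord_mono) auto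
    also have "\<dots> \<le> h (Suc i)" using h i by (auto simp: S_def concave_seq_chord[OF p])
    finally show "chord p u i \<le> h (Suc i)" .
  qed
  have cu: "concave_seq p n u" using conc by (simp add: concave_seq_chord[OF p])
  have contact: "u (Suc i) = G (Suc i)" if i: "i < n" and k: "slope p u (Suc i) < slope p u i" for i
  proof (rule ccontr)
    assume "u (Suc i) \<noteq> G (Suc i)"
    with G[of "Suc i"] i have lt: "G (Suc i) < u (Suc i)" by auto
    have lt2: "chord p u i < u (Suc i)"
      using k d[OF i] by (auto simp: chord_def slope_def divide_simps split: if_splits) (auto simp: algebra_simps)
    \<comment> \<open>If \<open>u\<close> bends strictly above the obstacle, lowering this single
      value to the larger of obstacle and chord gives a strictly smaller concave majorant: the chord
      at this node is unchanged and all others can only decrease.\<close>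
    define w where "w = u (Suc i := max (G (Suc i)) (chord p u i))"
    have wle: "w m \<le> u m" for m using lt lt2 by (auto simp: w_def)
    have "w \<in> S"
      unfolding S_def concave_seq_chord[OF p]
    proof (intro CollectI conjI allI impI)
      fix m assume m: "m < n"
      have "chord p w m \<le> chord p u m" using d[OF m] wle by (intro chord_mono) auto
      moreover have "chord p u m \<le> w (Suc m)" using conc[OF m] by (auto simp: w_def)
      ultimately show "chord p w m \<le> w (Suc m)" by simp
    next
      fix m assume "m \<le> Suc n" then show "G m \<le> w m" using G by (auto simp: w_def)
    qed
    then have "u (Suc i) \<le> w (Suc i)" using i by (intro lo) auto
    then show False using lt lt2 by (auto simp: w_def)
  qed
  have "h0 \<in> S" "h1 \<in> S" using h0 h1 by (auto simp: S_def)
  then have "u 0 = G 0" "u (Suc n) = G (Suc n)"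
    using lo[of h0 0] lo[of h1 "Suc n"] G[of 0] G[of "Suc n"] h0(3) h1(3) by auto
  then show ?thesis using that cu G contact lo by (auto simp: S_def)
qed

section \<open>Comparison with the affine interpolation of the boundary values\<close>

definition interp :: "(nat \<Rightarrow> real) \<Rightarrow> nat \<Rightarrow> real \<Rightarrow> real \<Rightarrow> nat \<Rightarrow> real" where
  "interp p n a b i = a + (b - a) / (p (Suc n) - p 0) * (p i - p 0)"

lemma grid_seq_less:
  assumes "grid_seq p n" "i < j" "j \<le> Suc n"
  shows "p i < p j"
proof -
  have "p i < p (Suc (i + m))" if "i + m \<le> n" for m
    using that
  proof (induction m)
    case (Suc m)
    then have "p i < p (Suc (i + m))" "p (Suc (i + m)) < p (Suc (i + Suc m))"
      using assms(1) by (auto simp: grid_seq_def)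
    then show ?case by simp
  qed (use assms(1) in \<open>auto simp: grid_seq_def\<close>)
  from this[of "j - Suc i"] show ?thesis using assms(2,3) by auto
qed

text \<open>Subtracting the interpolation leaves a concave sequence with zero boundary values, hence
  a nonnegative one.\<close>

lemma concave_seq_ge_interp:
  assumes "grid_seq p n" "concave_seq p n u" "m \<le> Suc n"
  shows "interp p n (u 0) (u (Suc n)) m \<le> u m"
proof -
  define s where "s = (u (Suc n) - u 0) / (p (Suc n) - p 0)"
  define w where "w = (\<lambda>i. u i + (- (u 0 - s * p 0) + (- s) * p i))"
  have "p 0 < p (Suc n)" using assms(1) by (intro grid_seq_less) auto
  then have "s * (p (Suc n) - p 0) = u (Suc n) - u 0" by (simp add: s_def)
  then have w0: "w 0 = 0" "w (Suc n) = 0" by (simp_all add: w_def algebra_simps)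
  have "concave_seq p n w"
    unfolding w_def using assms by (intro concave_seq_add concave_seq_affine)
  then have "w m \<ge> 0" using w0 concave_seq_nonneg[of p n w m] assms by (cases "m = Suc n") auto
  moreover have "interp p n (u 0) (u (Suc n)) m = u 0 + s * (p m - p 0)"
    by (simp add: interp_def s_def)
  ultimately show ?thesis by (simp add: w_def algebra_simps)
qed

text \<open>The concave majorant leaves its ends below the lines of slope \<open>\<plusminus>L\<close> unless it is affine, which
  bounds its total bending and its distance from the interpolation of its boundary values.\<close>
lemma least_concave_majorant_lipschitz:
  fixes G :: "nat \<Rightarrow> real"
  assumes p: "grid_seq p n" and L: "L \<ge> 0"
    and G0: "G 0 \<ge> 0" "G (Suc n) \<ge> 0"
    and GL: "\<And>i. i < n \<Longrightarrow> G (Suc i) \<le> L * (p (Suc i) - p 0)"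
    and GR: "\<And>i. i < n \<Longrightarrow> G (Suc i) \<le> L * (p (Suc n) - p (Suc i))"
  obtains u where "u 0 = G 0" "u (Suc n) = G (Suc n)" "concave_seq p n u"
    "\<And>i. i \<le> Suc n \<Longrightarrow> G i \<le> u i"
    "\<And>i. i < n \<Longrightarrow> slope p u (Suc i) < slope p u i \<Longrightarrow> u (Suc i) = G (Suc i)"
    "\<And>h i. concave_seq p n h \<Longrightarrow> (\<And>i. i \<le> Suc n \<Longrightarrow> G i \<le> h i) \<Longrightarrow> i \<le> Suc n \<Longrightarrow> u i \<le> h i"
    "slope p u 0 - slope p u n \<le> 2 * L"
    "\<And>i. i \<le> Suc n \<Longrightarrow> u i \<le> interp p n (G 0) (G (Suc n)) i
        + 2 * L * min (p i - p 0) (p (Suc n) - p i)"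
proof -
  define \<sigma> where "\<sigma> = (G (Suc n) - G 0) / (p (Suc n) - p 0)"
  have less: "p i < p j" if "i < j" "j \<le> Suc n" for i j using grid_seq_less[OF p that] .
  have le: "p i \<le> p j" if "i \<le> j" "j \<le> Suc n" for i j
    using less[of i j] that by (cases "i = j") auto
  have l: "p (Suc n) - p 0 > 0" using less[of 0 "Suc n"] by simp
  have \<sigma>: "G (Suc n) = G 0 + \<sigma> * (p (Suc n) - p 0)" using l by (simp add: \<sigma>_def)
  define h0 where "h0 i = G 0 + max \<sigma> L * (p i - p 0)" for i
  define h1 where "h1 i = G (Suc n) + max (- \<sigma>) L * (p (Suc n) - p i)" for i
  have "h0 = (\<lambda>i. (G 0 - max \<sigma> L * p 0) + max \<sigma> L * p i)"
    by (auto simp: h0_def algebra_simps)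
  then have c0: "concave_seq p n h0" using concave_seq_affine[OF p] by simp
  have "h1 = (\<lambda>i. (G (Suc n) + max (- \<sigma>) L * p (Suc n)) + (- max (- \<sigma>) L) * p i)"
    by (auto simp: h1_def algebra_simps)
  then have c1: "concave_seq p n h1" by (simp only: concave_seq_affine[OF p])
  have idx: "i = 0 \<or> i = Suc n \<or> (\<exists>m<n. i = Suc m)" if "i \<le> Suc n" for i
    using that by (cases i) (auto simp: le_less)
  have m0: "G i \<le> h0 i" if i: "i \<le> Suc n" for i
  proof -
    consider "i = 0" | "i = Suc n" | m where "m < n" "i = Suc m" using idx[OF i] by blast
    then show ?thesis
    proof cases
      case 2
      have "\<sigma> * (p (Suc n) - p 0) \<le> max \<sigma> L * (p (Suc n) - p 0)" using l by (intro mult_right_mono) auto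
      then show ?thesis using 2 \<sigma> by (simp add: h0_def)
    next
      case 3
      have "L * (p (Suc m) - p 0) \<le> max \<sigma> L * (p (Suc m) - p 0)"
        using le[of 0 "Suc m"] 3 by (intro mult_right_mono) auto
      then show ?thesis using 3 GL[of m] G0 by (simp add: h0_def)
    qed (simp add: h0_def)
  qed
  have m1: "G i \<le> h1 i" if i: "i \<le> Suc n" for i
  proof -
    consider "i = 0" | "i = Suc n" | m where "m < n" "i = Suc m" using idx[OF i] by blast
    then show ?thesis
    proof cases
      case 1
      have "- \<sigma> * (p (Suc n) - p 0) \<le> max (- \<sigma>) L * (p (Suc n) - p 0)" using l by (intro mult_right_mono) auto
      then show ?thesis using 1 \<sigma> by (simp add: h1_def)
    next
      case 3
      have "L * (p (Suc n) - p (Suc m)) \<le> max (- \<sigma>) L * (p (Suc n) - p (Suc m))"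
        using le[of "Suc m" "Suc n"] 3 by (intro mult_right_mono) auto
      then show ?thesis using 3 GR[of m] G0 by (simp add: h1_def)
    qed (simp add: h1_def)
  qed
  obtain u where u: "u 0 = G 0" "u (Suc n) = G (Suc n)" "concave_seq p n u"
    "\<And>i. i \<le> Suc n \<Longrightarrow> G i \<le> u i"
    "\<And>i. i < n \<Longrightarrow> slope p u (Suc i) < slope p u i \<Longrightarrow> u (Suc i) = G (Suc i)"
    "\<And>h i. concave_seq p n h \<Longrightarrow> (\<And>i. i \<le> Suc n \<Longrightarrow> G i \<le> h i) \<Longrightarrow> i \<le> Suc n \<Longrightarrow> u i \<le> h i"
    using least_concave_majorant[OF p c0 m0 _ c1 m1] by (auto simp: h0_def h1_def)
  have uh0: "u i \<le> h0 i" if "i \<le> Suc n" for i using u(6)[OF c0 m0 that] .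
  have uh1: "u i \<le> h1 i" if "i \<le> Suc n" for i using u(6)[OF c1 m1 that] .
  define lin where "lin = interp p n (G 0) (G (Suc n))"
  have lin0: "lin i = G 0 + \<sigma> * (p i - p 0)" for i by (simp add: lin_def interp_def \<sigma>_def)
  have lin1: "lin i = G (Suc n) - \<sigma> * (p (Suc n) - p i)" for i
    unfolding lin0 \<sigma> by (simp add: algebra_simps)
  \<comment> \<open>If \<open>\<bar>\<sigma>\<bar> \<ge> L\<close>, one of \<open>h0\<close> and
    \<open>h1\<close> is the interpolation itself and there is no excess. Otherwise \<open>L\<close>
    is at most both \<open>\<sigma> + 2 * L\<close> and \<open>- \<sigma> + 2 * L\<close>, whence
    the factor \<open>2 * L\<close>.\<close>
  have dist: "u i \<le> lin i + (if \<bar>\<sigma>\<bar> < L then 2 * L * min (p i - p 0) (p (Suc n) - p i) else 0)"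
    if i: "i \<le> Suc n" for i
  proof -
    have d: "0 \<le> p i - p 0" "0 \<le> p (Suc n) - p i" using le i by auto
    consider "\<sigma> \<ge> L" | "\<sigma> \<le> - L" | "\<bar>\<sigma>\<bar> < L" by linarith
    then show ?thesis
    proof cases
      case 1 then show ?thesis using uh0[OF i] by (auto simp: h0_def lin0 max_def)
    next
      case 2
      then have "max (- \<sigma>) L = - \<sigma>" by simp
      then show ?thesis using uh1[OF i] L 2 by (auto simp: h1_def lin1)
    next
      case 3
      have "L * (p i - p 0) \<le> (\<sigma> + 2 * L) * (p i - p 0)" using 3 d by (intro mult_right_mono) auto
      moreover have "L * (p (Suc n) - p i) \<le> (- \<sigma> + 2 * L) * (p (Suc n) - p i)"
        using 3 d by (intro mult_right_mono) auto
      moreover have "max \<sigma> L = L" "max (- \<sigma>) L = L" using 3 by auto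
      ultimately have "u i \<le> G 0 + (\<sigma> + 2 * L) * (p i - p 0)"
          "u i \<le> G (Suc n) + (- \<sigma> + 2 * L) * (p (Suc n) - p i)"
        using uh0[OF i] uh1[OF i] by (auto simp: h0_def h1_def)
      then have "u i \<le> lin i + 2 * L * (p i - p 0)" "u i \<le> lin i + 2 * L * (p (Suc n) - p i)"
        using lin0[of i] lin1[of i] by (auto simp: algebra_simps)
      then show ?thesis using 3 by (auto simp: min_def)
    qed
  qed
  have sl: "slope p u 0 \<le> s" if "u (Suc 0) \<le> G 0 + s * (p (Suc 0) - p 0)" for s
    using that u(1) less[of 0 "Suc 0"] by (simp add: slope_def divide_simps algebra_simps)
  have sr: "- s \<le> slope p u n" if "u n \<le> G (Suc n) + s * (p (Suc n) - p n)" for s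
    using that u(2) less[of n "Suc n"] by (simp add: slope_def divide_simps algebra_simps)
  \<comment> \<open>In the first case the end slopes are bounded by \<open>L\<close> and
    \<open>- L\<close>; in the affine case the first slope is at most \<open>\<sigma>\<close> and
    the last at least \<open>\<sigma>\<close>.\<close>
  have bend: "slope p u 0 - slope p u n \<le> 2 * L"
  proof (cases "\<bar>\<sigma>\<bar> < L")
    case True
    then have "slope p u 0 \<le> L" "- L \<le> slope p u n"
      using sl[of L] sr[of L] uh0[of "Suc 0"] uh1[of n] by (auto simp: h0_def h1_def)
    then show ?thesis by simp
  next
    case False
    then have "slope p u 0 \<le> \<sigma>" "\<sigma> \<le> slope p u n"
      using sl[of \<sigma>] sr[of "- \<sigma>"] dist[of "Suc 0"] dist[of n] lin0[of "Suc 0"] lin1[of n] by auto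
    then show ?thesis using L by simp
  qed
  have dist': "u i \<le> interp p n (G 0) (G (Suc n)) i + 2 * L * min (p i - p 0) (p (Suc n) - p i)"
    if i: "i \<le> Suc n" for i
  proof -
    have "0 \<le> 2 * L * min (p i - p 0) (p (Suc n) - p i)" using le i L by auto
    with dist[OF i] show ?thesis by (auto simp: lin_def split: if_splits)
  qed
  show ?thesis using that u bend dist' by blast
qed

text \<open>The tent is a minimum of three affine sequences, and at each node one that attains the
  minimum is a supporting line. The two sloping ones control the end slopes.\<close>

lemma concave_tent:
  fixes p :: "nat \<Rightarrow> real" and m :: real
  assumes p: "grid_seq p n" and L: "L \<ge> 0" and m: "m \<ge> 0"
  defines "h \<equiv> (\<lambda>i. min m (L * min (p i - p 0) (p (Suc n) - p i)))"
  shows "concave_seq p n h" "h 0 = 0" "h (Suc n) = 0" "slope p h 0 - slope p h n \<le> 2 * L"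
    "\<And>i. i \<le> Suc n \<Longrightarrow> 0 \<le> h i"
proof -
  have less: "p i < p j" if "i < j" "j \<le> Suc n" for i j using grid_seq_less[OF p that] .
  have le: "p i \<le> p j" if "i \<le> j" "j \<le> Suc n" for i j
    using less[of i j] that by (cases "i = j") auto
  have eq: "h i = min m (min (- L * p 0 + L * p i) (L * p (Suc n) + (- L) * p i))" for i
    using L by (auto simp: h_def min_mult_distrib_left algebra_simps)
  show "concave_seq p n h"
  proof (rule concave_seq_touching_affine[OF p])
    fix i
    have "h (Suc i) = m \<or> h (Suc i) = - L * p 0 + L * p (Suc i)
        \<or> h (Suc i) = L * p (Suc n) + (- L) * p (Suc i)" unfolding eq by linarith
    moreover have "h j \<le> m" "h j \<le> - L * p 0 + L * p j" "h j \<le> L * p (Suc n) + (- L) * p j" for j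
      unfolding eq by auto
    ultimately show "\<exists>c s. h (Suc i) = c + s * p (Suc i) \<and> h i \<le> c + s * p i
      \<and> h (Suc (Suc i)) \<le> c + s * p (Suc (Suc i))"
      by (metis add.right_neutral mult_zero_left)
  qed
  show pos: "0 \<le> h i" if "i \<le> Suc n" for i using le that L m by (auto simp: h_def)
  have b: "h i \<le> L * (p i - p 0)" "h i \<le> L * (p (Suc n) - p i)" for i
    using L by (auto simp: h_def min_mult_distrib_left)
  show z: "h 0 = 0" "h (Suc n) = 0" using b[of 0] b[of "Suc n"] pos[of 0] pos[of "Suc n"] by auto
  have "slope p h 0 \<le> L" using b(1)[of "Suc 0"] z less[of 0 "Suc 0"] by (simp add: slope_def divide_simps)
  moreover have "- L \<le> slope p h n" using b(2)[of n] z less[of n "Suc n"] by (simp add: slope_def divide_simps)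
  ultimately show "slope p h 0 - slope p h n \<le> 2 * L" by simp
qed

lemma interp_diff: "interp p n a b i - interp p n a' b' i = interp p n (a - a') (b - b') i"
  by (simp add: interp_def algebra_simps diff_divide_distrib add_divide_distrib)

lemma interp_ge:
  assumes "grid_seq p n" "i \<le> Suc n" "c \<le> a" "c \<le> b"
  shows "c \<le> interp p n a b i"
proof -
  have le: "p i \<le> p j" if "i \<le> j" "j \<le> Suc n" for i j
    using grid_seq_less[OF assms(1), of i j] that by (cases "i = j") auto
  define t where "t = (p i - p 0) / (p (Suc n) - p 0)"
  have "p 0 < p (Suc n)" using grid_seq_less[OF assms(1), of 0 "Suc n"] by simp
  then have t: "0 \<le> t" "t \<le> 1" using le[of 0 i] le[of i "Suc n"] assms(2) by (auto simp: t_def)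
  have "c = (1 - t) * c + t * c" by (simp add: algebra_simps)
  also have "\<dots> \<le> (1 - t) * a + t * b" using t assms by (intro add_mono mult_left_mono) auto
  also have "\<dots> = a + (b - a) * t" by (simp add: algebra_simps)
  also have "\<dots> = interp p n a b i" by (simp add: interp_def t_def)
  finally show ?thesis .
qed

subsection \<open>Gaussian integrals on finite products\<close>

text \<open>The product measure is determined by its values on boxes, where the identity reduces to
  the one-dimensional affine change of variables, with one factor \<open>\<bar>c\<bar>\<close> per
  coordinate.\<close>

lemma PiM_lborel_affine:
  fixes t :: "'i \<Rightarrow> real" and c :: real
  assumes "finite I" "c \<noteq> 0"
  defines "M \<equiv> PiM I (\<lambda>_. lborel :: real measure)"
  defines "\<tau> \<equiv> (\<lambda>x. \<lambda>i\<in>I. t i + c * x i)"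
  shows "M = density (distr M M \<tau>) (\<lambda>_. ennreal (\<bar>c\<bar> ^ card I))"
proof -
  interpret product_sigma_finite "\<lambda>_::'i. lborel :: real measure" ..
  have [measurable]: "\<tau> \<in> measurable M M" unfolding \<tau>_def M_def by measurable
  have "density (distr M M \<tau>) (\<lambda>_. ennreal (\<bar>c\<bar> ^ card I)) = PiM I (\<lambda>_. lborel)"
  proof (rule PiM_eqI[OF assms(1)])
    show "sets (density (distr M M \<tau>) (\<lambda>_. ennreal (\<bar>c\<bar> ^ card I))) = sets (PiM I (\<lambda>_. lborel))"
      by (simp add: M_def)
    fix A assume A: "\<And>i. i \<in> I \<Longrightarrow> A i \<in> sets (lborel :: real measure)"
    let ?B = "\<lambda>i. (\<lambda>x. t i + c * x) -` A i"
    have B: "?B i \<in> sets lborel" if "i \<in> I" for i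
      using measurable_sets_borel[of "\<lambda>x. t i + c * x" borel "A i"] A[OF that] by simp
    have 1: "emeasure lborel (A i) = ennreal \<bar>c\<bar> * emeasure lborel (?B i)" if "i \<in> I" for i
    proof -
      have "emeasure lborel (A i) = emeasure (density (distr lborel borel (\<lambda>x. t i + c * x)) (\<lambda>_. \<bar>c\<bar>)) (A i)"
        using lborel_real_affine[OF assms(2), of "t i"] by simp
      also have "\<dots> = ennreal \<bar>c\<bar> * emeasure (distr lborel borel (\<lambda>x. t i + c * x)) (A i)"
        using A[OF that] by (subst emeasure_density_const) auto
      finally show ?thesis using A[OF that] by (simp add: emeasure_distr)
    qed
    have AM: "PiE I A \<in> sets M" unfolding M_def using A assms(1) by (intro sets_PiM_I_finite) auto
    have vim: "\<tau> -` PiE I A \<inter> space M = PiE I ?B"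
      by (auto simp: \<tau>_def M_def space_PiM PiE_def Pi_def)
    have "emeasure (density (distr M M \<tau>) (\<lambda>_. ennreal (\<bar>c\<bar> ^ card I))) (PiE I A)
        = ennreal (\<bar>c\<bar> ^ card I) * emeasure M (PiE I ?B)"
      using AM vim by (subst emeasure_density_const) (auto simp: emeasure_distr)
    also have "emeasure M (PiE I ?B) = (\<Prod>i\<in>I. emeasure lborel (?B i))"
      unfolding M_def using B assms(1) by (intro emeasure_PiM) auto
    also have "ennreal (\<bar>c\<bar> ^ card I) * \<dots> = (\<Prod>i\<in>I. ennreal \<bar>c\<bar> * emeasure lborel (?B i))"
      by (simp add: prod.distrib ennreal_power[symmetric])
    also have "\<dots> = (\<Prod>i\<in>I. emeasure lborel (A i))" using 1 by (intro prod.cong) auto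
    finally show "emeasure (density (distr M M \<tau>) (\<lambda>_. ennreal (\<bar>c\<bar> ^ card I))) (PiE I A)
        = (\<Prod>i\<in>I. emeasure lborel (A i))" .
  qed
  then show ?thesis by (simp add: M_def)
qed

text \<open>Two cases are used below: translations (\<open>c = 1\<close>) recentre the density,
  dilations (\<open>t\<close> zero) rescale the energy.\<close>

lemma
  fixes t :: "'i \<Rightarrow> real" and c :: real and F :: "('i \<Rightarrow> real) \<Rightarrow> real"
  assumes "finite I" "c \<noteq> 0"
  defines "M \<equiv> PiM I (\<lambda>_. lborel :: real measure)"
  assumes [measurable]: "F \<in> borel_measurable M"
  shows integral_PiM_affine:
      "integral\<^sup>L M F = \<bar>c\<bar> ^ card I * (LINT x|M. F (\<lambda>i\<in>I. t i + c * x i))" (is ?A)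
    and integrable_PiM_affine:
      "integrable M F \<longleftrightarrow> integrable M (\<lambda>x. F (\<lambda>i\<in>I. t i + c * x i))" (is ?B)
proof -
  have [measurable]: "(\<lambda>x. \<lambda>i\<in>I. t i + c * x i) \<in> measurable M M" unfolding M_def by measurable
  note eq = PiM_lborel_affine[OF assms(1,2), of t, folded M_def]
  have c: "\<bar>c\<bar> ^ card I > 0" using assms(2) by simp
  show ?A
    by (subst eq, subst integral_density) (auto simp: integral_distr)
  have "integrable M F \<longleftrightarrow> integrable (distr M M (\<lambda>x. \<lambda>i\<in>I. t i + c * x i)) (\<lambda>x. (\<bar>c\<bar> ^ card I) *\<^sub>R F x)"
    by (subst eq, rule integrable_density) (auto simp del: distr_id)
  also have "\<dots> \<longleftrightarrow> integrable M (\<lambda>x. (\<bar>c\<bar> ^ card I) *\<^sub>R F (\<lambda>i\<in>I. t i + c * x i))"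
    by (subst integrable_distr_eq) auto
  also have "\<dots> \<longleftrightarrow> integrable M (\<lambda>x. F (\<lambda>i\<in>I. t i + c * x i))"
    using c by auto
  finally show ?B .
qed

lemma integrable_exp_neg_square:
  assumes "c > 0"
  shows "integrable lborel (\<lambda>x::real. exp (- c * x\<^sup>2))"
proof -
  define s where "s = sqrt (1 / (2 * c))"
  have s: "s > 0" "s\<^sup>2 = 1 / (2 * c)" using assms by (auto simp: s_def)
  have "integrable lborel (\<lambda>x. sqrt (2 * pi * s\<^sup>2) * normal_density 0 s x)"
    using s by (intro integrable_mult_right integrable_normal_density)
  also have "(\<lambda>x. sqrt (2 * pi * s\<^sup>2) * normal_density 0 s x) = (\<lambda>x::real. exp (- c * x\<^sup>2))"
    using s assms by (auto simp: normal_density_def)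
  finally show ?thesis .
qed

text \<open>Averaging the coordinate bounds dominates the integrand by a product of one-dimensional
  Gaussians. The divisor \<open>real (card I) + 1\<close> stays positive for empty
  \<open>I\<close>.\<close>

lemma integrable_exp_neg_quadratic:
  fixes q :: "('i \<Rightarrow> real) \<Rightarrow> real"
  assumes "finite I" "\<epsilon> > 0"
  defines "M \<equiv> PiM I (\<lambda>_. lborel :: real measure)"
  assumes [measurable]: "q \<in> borel_measurable M"
    and q: "\<And>x i. x \<in> space M \<Longrightarrow> i \<in> I \<Longrightarrow> \<epsilon> * (x i)\<^sup>2 \<le> q x" "\<And>x. x \<in> space M \<Longrightarrow> 0 \<le> q x"
  shows "integrable M (\<lambda>x. exp (- q x))"
proof -
  interpret product_sigma_finite "\<lambda>_::'i. lborel :: real measure" ..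
  define c where "c = \<epsilon> / (real (card I) + 1)"
  have c: "c > 0" using assms(2) by (auto simp: c_def)
  have "integrable M (\<lambda>x. \<Prod>i\<in>I. exp (- c * (x i)\<^sup>2))"
    unfolding M_def using assms(1) c
    by (intro product_integrable_prod integrable_exp_neg_square)
  then show ?thesis
  proof (rule Bochner_Integration.integrable_bound)
    show "AE x in M. norm (exp (- q x)) \<le> norm (\<Prod>i\<in>I. exp (- c * (x i)\<^sup>2))"
    proof (rule AE_I2)
      fix x assume x: "x \<in> space M"
      have "(\<Sum>i\<in>I. c * (x i)\<^sup>2) = (\<Sum>i\<in>I. \<epsilon> * (x i)\<^sup>2) / (real (card I) + 1)"
        by (simp add: c_def sum_divide_distrib)
      also have "\<dots> \<le> (\<Sum>i\<in>I. q x) / (real (card I) + 1)"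
        using q(1)[OF x] by (intro divide_right_mono sum_mono) auto
      also have "\<dots> \<le> q x" using q(2)[OF x] by (simp add: field_simps)
      finally show "norm (exp (- q x)) \<le> norm (\<Prod>i\<in>I. exp (- c * (x i)\<^sup>2))"
        using assms(1) by (simp add: exp_sum[symmetric] sum_negf abs_prod[symmetric] prod_nonneg)
    qed
  qed measurable
qed

text \<open>Scaling by \<open>\<surd>2\<close> shows that half of the mass lies in \<open>{q \<le> 2N + 2}\<close>; contracting this set
  to \<open>{q \<le> \<kappa>}\<close> increases the density.\<close>
lemma gaussian_small_energy:
  fixes q :: "('i \<Rightarrow> real) \<Rightarrow> real"
  assumes "finite I"
  defines "M \<equiv> PiM I (\<lambda>_. lborel :: real measure)" and "N \<equiv> card I"
  assumes [measurable]: "q \<in> borel_measurable M"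
    and pos: "\<And>x. x \<in> space M \<Longrightarrow> 0 \<le> q x"
    and hom: "\<And>c x. x \<in> space M \<Longrightarrow> q (\<lambda>i\<in>I. c * x i) = c\<^sup>2 * q x"
    and int: "integrable M (\<lambda>x. exp (- q x))"
    and \<kappa>: "0 < \<kappa>" "\<kappa> \<le> 2 * real N + 2"
  shows "(LINT x|M. exp (- q x) * indicator {x. q x \<le> \<kappa>} x)
    \<ge> sqrt (\<kappa> / (2 * real N + 2)) ^ N / 2 * (LINT x|M. exp (- q x))"
proof -
  \<comment> \<open>Chosen so that \<open>exp (- R / 2) * sqrt 2 ^ N\<close> is at most
    \<open>inverse (exp 1)\<close>, hence at most one half. Contraction by \<open>\<theta>\<close>
    takes energy \<open>R\<close> to energy \<open>\<kappa>\<close>.\<close>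
  define R where "R = 2 * real N + 2"
  define \<theta> where "\<theta> = sqrt (\<kappa> / R)"
  have R: "R > 0" by (simp add: R_def)
  have \<theta>: "\<theta> > 0" "\<theta>\<^sup>2 * R = \<kappa>" "\<theta>\<^sup>2 \<le> 1" using \<kappa> R by (auto simp: \<theta>_def R_def divide_le_eq)
  let ?Z = "LINT x|M. exp (- q x)"
  have Z: "?Z \<ge> 0" by (intro integral_nonneg_AE) auto
  have meas2: "(\<lambda>x. exp (- q x / 2)) \<in> borel_measurable M" by measurable
  have hom': "q (\<lambda>i\<in>I. 0 + c * x i) = c\<^sup>2 * q x" if "x \<in> space M" for c x
    using hom[OF that] by simp
  have "integrable M (\<lambda>x. exp (- q (\<lambda>i\<in>I. 0 + sqrt 2 * x i) / 2)) \<longleftrightarrow> integrable M (\<lambda>x. exp (- q x))"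
    by (rule Bochner_Integration.integrable_cong) (auto simp: hom' simp del: add_0)
  with integrable_PiM_affine[OF assms(1), of "sqrt 2" "\<lambda>x. exp (- q x / 2)" "\<lambda>_. 0", folded M_def, OF _ meas2] int
  have int2: "integrable M (\<lambda>x. exp (- q x / 2))" by (simp del: add_0)
  have "(LINT x|M. exp (- q (\<lambda>i\<in>I. 0 + sqrt 2 * x i) / 2)) = ?Z"
    by (rule Bochner_Integration.integral_cong) (auto simp: hom' simp del: add_0)
  with integral_PiM_affine[OF assms(1), of "sqrt 2" "\<lambda>x. exp (- q x / 2)" "\<lambda>_. 0", folded M_def, OF _ meas2]
  have Z2: "(LINT x|M. exp (- q x / 2)) = sqrt 2 ^ N * ?Z" by (simp add: N_def del: add_0)
  have intR: "integrable M (\<lambda>x. exp (- q x) * indicator {x. q x \<le> R} x)"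
    by (rule Bochner_Integration.integrable_bound[OF int]) (auto split: split_indicator)
  have intk: "integrable M (\<lambda>x. exp (- q x) * indicator {x. q x \<le> \<kappa>} x)"
    by (rule Bochner_Integration.integrable_bound[OF int]) (auto split: split_indicator)
  \<comment> \<open>Split at level \<open>R\<close>: above it, \<open>exp (- q x)\<close> is at most
    \<open>exp (- R / 2) * exp (- q x / 2)\<close>, and the last factor integrates to
    \<open>sqrt 2 ^ N * ?Z\<close>.\<close>
  have "?Z \<le> (LINT x|M. exp (- q x) * indicator {x. q x \<le> R} x + exp (- R / 2) * exp (- q x / 2))"
  proof (rule integral_mono)
    fix x
    show "exp (- q x) \<le> exp (- q x) * indicator {x. q x \<le> R} x + exp (- R / 2) * exp (- q x / 2)"
      by (auto split: split_indicator simp: exp_add[symmetric])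
  qed (use int intR int2 in auto)
  also have "\<dots> = (LINT x|M. exp (- q x) * indicator {x. q x \<le> R} x) + exp (- R / 2) * (sqrt 2 ^ N * ?Z)"
    using intR int2 Z2 by simp
  finally have 1: "?Z \<le> (LINT x|M. exp (- q x) * indicator {x. q x \<le> R} x) + exp (- R / 2) * sqrt 2 ^ N * ?Z"
    by simp
  have e2: "exp 1 \<ge> (2::real)" using exp_ge_add_one_self[of 1] by simp
  have "exp (- R / 2) * sqrt 2 ^ N \<le> exp (- R / 2) * exp (real N)"
  proof -
    have "sqrt 2 \<le> exp 1" using e2 sqrt_le_D[of 2 2] real_sqrt_le_iff[of 2 4] by simp
    then have "sqrt 2 ^ N \<le> exp 1 ^ N" by (intro power_mono) auto
    then show ?thesis by (simp add: exp_of_nat_mult[symmetric])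
  qed
  also have "\<dots> = inverse (exp 1)" by (simp add: R_def exp_add[symmetric] exp_minus[symmetric] field_simps)
  also have "\<dots> \<le> 1 / 2" using e2 by (simp add: field_simps)
  finally have "exp (- R / 2) * sqrt 2 ^ N * ?Z \<le> 1 / 2 * ?Z" using Z by (intro mult_right_mono)
  with 1 have 2: "?Z / 2 \<le> (LINT x|M. exp (- q x) * indicator {x. q x \<le> R} x)" by simp
  let ?F = "\<lambda>x. exp (- q x) * indicator {x. q x \<le> \<kappa>} x :: real"
  have measF: "?F \<in> borel_measurable M" by measurable
  \<comment> \<open>The factor \<open>\<theta> ^ N\<close> is the Jacobian of the
    contraction.\<close>
  have "\<theta> ^ N * (?Z / 2) \<le> \<theta> ^ N * (LINT x|M. exp (- q x) * indicator {x. q x \<le> R} x)"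
    using 2 \<theta> by (intro mult_left_mono) auto
  also have "\<dots> \<le> \<theta> ^ N * (LINT x|M. ?F (\<lambda>i\<in>I. 0 + \<theta> * x i))"
  proof (intro mult_left_mono integral_mono intR)
    show "integrable M (\<lambda>x. ?F (\<lambda>i\<in>I. 0 + \<theta> * x i))"
      using integrable_PiM_affine[OF assms(1), of \<theta> ?F "\<lambda>_. 0", folded M_def, OF _ measF] intk \<theta>
      by (simp del: add_0)
    fix x assume x: "x \<in> space M"
    have a: "\<theta>\<^sup>2 * q x \<le> q x" using pos[OF x] \<theta>(3) by (intro mult_left_le_one_le) auto
    have b: "\<theta>\<^sup>2 * q x \<le> \<kappa>" if "q x \<le> R"
      using mult_left_mono[OF that, of "\<theta>\<^sup>2"] \<theta> by simp
    show "exp (- q x) * indicator {x. q x \<le> R} x \<le> ?F (\<lambda>i\<in>I. 0 + \<theta> * x i)"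
      using a b by (auto simp: hom'[OF x] split: split_indicator simp del: add_0)
  qed (use \<theta> in auto)
  also have "\<dots> = integral\<^sup>L M ?F"
    using integral_PiM_affine[OF assms(1), of \<theta> ?F "\<lambda>_. 0", folded M_def, OF _ measF] \<theta>
    by (simp add: N_def del: add_0)
  finally show ?thesis by (simp add: \<theta>_def R_def)
qed

text \<open>Recentring the denominator at \<open>m0\<close> and the numerator at \<open>m1\<close>
  compares both with the same centred Gaussian, whose mass cancels. The upper bound is required on
  all of \<open>A\<close>, the lower bound only at small energy; the last factor bounds the share of
  the mass found there.\<close>

lemma conditioned_gaussian_lower_bound:
  fixes q :: "('i \<Rightarrow> real) \<Rightarrow> real" and c0 c1 :: real
  assumes "finite I"
  defines "M \<equiv> PiM I (\<lambda>_. lborel :: real measure)" and "N \<equiv> card I"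
  assumes [measurable]: "q \<in> borel_measurable M" "F \<in> borel_measurable M"
      "(\<lambda>x. indicator A x :: real) \<in> borel_measurable M" "(\<lambda>x. indicator H x :: real) \<in> borel_measurable M"
    and pos: "\<And>x. x \<in> space M \<Longrightarrow> 0 \<le> q x"
    and hom: "\<And>c x. x \<in> space M \<Longrightarrow> q (\<lambda>i\<in>I. c * x i) = c\<^sup>2 * q x"
    and int: "integrable M (\<lambda>x. exp (- q x))"
    and \<kappa>: "0 < \<kappa>" "\<kappa> \<le> 2 * real N + 2"
    and F: "\<And>x. 0 \<le> F x"
    and HA: "H \<subseteq> A"
    and c: "0 < c0" "0 < c1"
    and up: "\<And>y. y \<in> space M \<Longrightarrow> (\<lambda>i\<in>I. m0 i + y i) \<in> A \<Longrightarrow> F (\<lambda>i\<in>I. m0 i + y i) \<le> c0 * exp (- q y)"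
    and low: "\<And>y. y \<in> space M \<Longrightarrow> q y \<le> \<kappa> \<Longrightarrow> (\<lambda>i\<in>I. m1 i + y i) \<in> H
      \<and> c1 * exp (- q y) \<le> F (\<lambda>i\<in>I. m1 i + y i)"
  shows "(LINT x|M. F x * indicator H x) / (LINT x|M. F x * indicator A x)
    \<ge> c1 / c0 * (sqrt (\<kappa> / (2 * real N + 2)) ^ N / 2)"
proof -
  let ?Z = "LINT x|M. exp (- q x)" and ?s = "sqrt (\<kappa> / (2 * real N + 2)) ^ N / 2"
  have s: "?s > 0" using \<kappa> by simp
  have meas: "(\<lambda>x. F x * indicator A x) \<in> borel_measurable M" "(\<lambda>x. F x * indicator H x) \<in> borel_measurable M"
    by measurable
  note intA = integrable_PiM_affine[OF assms(1), of 1 "\<lambda>x. F x * indicator A x" m0, folded M_def, OF _ meas(1)]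
  note eqA = integral_PiM_affine[OF assms(1), of 1 "\<lambda>x. F x * indicator A x" m0, folded M_def, OF _ meas(1)]
  note intH = integrable_PiM_affine[OF assms(1), of 1 "\<lambda>x. F x * indicator H x" m1, folded M_def, OF _ meas(2)]
  note eqH = integral_PiM_affine[OF assms(1), of 1 "\<lambda>x. F x * indicator H x" m1, folded M_def, OF _ meas(2)]
  have bA: "F (\<lambda>i\<in>I. m0 i + y i) * indicator A (\<lambda>i\<in>I. m0 i + y i) \<le> c0 * exp (- q y)" if "y \<in> space M" for y
    using up[OF that] c by (auto split: split_indicator)
  have tr [measurable]: "(\<lambda>x. \<lambda>i\<in>I. m0 i + x i) \<in> measurable M M" unfolding M_def by measurable
  have "integrable M (\<lambda>y. F (\<lambda>i\<in>I. m0 i + y i) * indicator A (\<lambda>i\<in>I. m0 i + y i))"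
  proof (rule Bochner_Integration.integrable_bound[of M "\<lambda>y. c0 * exp (- q y)"])
    show "(\<lambda>y. F (\<lambda>i\<in>I. m0 i + y i) * indicator A (\<lambda>i\<in>I. m0 i + y i)) \<in> borel_measurable M"
      using measurable_compose[OF tr meas(1)] .
    show "AE y in M. norm (F (\<lambda>i\<in>I. m0 i + y i) * indicator A (\<lambda>i\<in>I. m0 i + y i)) \<le> norm (c0 * exp (- q y))"
      using bA F c by (intro AE_I2) simp
  qed (use int in simp)
  note iA' = this
  then have iA: "integrable M (\<lambda>x. F x * indicator A x)" using intA by simp
  have iH: "integrable M (\<lambda>x. F x * indicator H x)"
    using HA F by (intro Bochner_Integration.integrable_bound[OF iA]) (auto split: split_indicator)
  have iH': "integrable M (\<lambda>y. F (\<lambda>i\<in>I. m1 i + y i) * indicator H (\<lambda>i\<in>I. m1 i + y i))"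
    using intH iH by simp
  have den: "(LINT x|M. F x * indicator A x) \<le> c0 * ?Z"
  proof -
    have "(LINT x|M. F x * indicator A x) \<le> (LINT y|M. c0 * exp (- q y))"
      unfolding eqA[OF one_neq_zero] abs_one power_one mult_1
      using iA' int bA by (intro integral_mono) auto
    then show ?thesis by simp
  qed
  have num: "c1 * (?s * ?Z) \<le> (LINT x|M. F x * indicator H x)"
  proof -
    have "c1 * (?s * ?Z) \<le> c1 * (LINT x|M. exp (- q x) * indicator {x. q x \<le> \<kappa>} x)"
      using gaussian_small_energy[OF assms(1), folded M_def N_def, of q \<kappa>] pos hom int \<kappa> c
      by (intro mult_left_mono) auto
    also have "\<dots> = (LINT x|M. c1 * (exp (- q x) * indicator {x. q x \<le> \<kappa>} x))" by simp
    also have "\<dots> \<le> (LINT y|M. F (\<lambda>i\<in>I. m1 i + y i) * indicator H (\<lambda>i\<in>I. m1 i + y i))"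
    proof (rule integral_mono[OF _ iH'])
      show "integrable M (\<lambda>x. c1 * (exp (- q x) * indicator {x. q x \<le> \<kappa>} x))"
        by (intro integrable_mult_right Bochner_Integration.integrable_bound[OF int]) (auto split: split_indicator)
      fix y assume "y \<in> space M"
      from low[OF this] show "c1 * (exp (- q y) * indicator {x. q x \<le> \<kappa>} y)
          \<le> F (\<lambda>i\<in>I. m1 i + y i) * indicator H (\<lambda>i\<in>I. m1 i + y i)"
        using F by (auto split: split_indicator)
    qed
    finally show ?thesis using eqH by simp
  qed
  \<comment> \<open>The integrand is positive, and the space has nonzero measure: a product of
    infinite factors, or \<open>1\<close> for empty \<open>I\<close>.\<close>
  have Z: "?Z > 0"
  proof -
    have "?Z \<noteq> 0"
    proof
      assume "?Z = 0"
      then have "AE x in M. exp (- q x) = 0"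
        using int by (subst (asm) integral_nonneg_eq_0_iff_AE) auto
      then have "emeasure M (space M) = 0" by (auto simp: eventually_ae_filter emeasure_eq_0 dest: emeasure_eq_0)
      moreover have "emeasure M (space M) = (\<Prod>i\<in>I. emeasure lborel (UNIV :: real set))"
      proof -
        interpret product_sigma_finite "\<lambda>_::'i. lborel :: real measure" ..
        show ?thesis using emeasure_PiM[OF assms(1), of "\<lambda>_. UNIV"] by (simp add: M_def space_PiM)
      qed
      ultimately show False using assms(1) by simp
    qed
    moreover have "?Z \<ge> 0" by (intro integral_nonneg_AE) auto
    ultimately show ?thesis by linarith
  qed
  \<comment> \<open>Division by zero yields zero in HOL, so the denominator must be shown positive;
    it dominates the numerator, which is positive by \<open>num\<close>.\<close>
  have "(LINT x|M. F x * indicator H x) \<le> (LINT x|M. F x * indicator A x)"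
    using HA F by (intro integral_mono iA iH) (auto split: split_indicator)
  moreover have "0 < c1 * (?s * ?Z)" using c s Z by simp
  ultimately have "0 < (LINT x|M. F x * indicator A x)" using num by linarith
  then have "c1 * (?s * ?Z) / (c0 * ?Z) \<le> (LINT x|M. F x * indicator H x) / (LINT x|M. F x * indicator A x)"
    using num den \<open>0 < c1 * (?s * ?Z)\<close> by (intro frac_le) linarith+
  then show ?thesis using Z by (simp add: field_simps)
qed

subsection \<open>Bridges on the grid\<close>

definition grid :: "real \<Rightarrow> real \<Rightarrow> real set \<Rightarrow> nat \<Rightarrow> real" where
  "grid l r P i = ([l] @ sorted_list_of_set P @ [r]) ! i"

lemma grid_0: "grid l r P 0 = l"
  by (simp add: grid_def)

lemma grid_last: "grid l r P (Suc (card P)) = r"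
  by (simp add: grid_def nth_append)

lemma grid_Suc: "i < card P \<Longrightarrow> grid l r P (Suc i) = sorted_list_of_set P ! i"
  by (simp add: grid_def nth_append)

lemma bij_betw_grid: "finite P \<Longrightarrow> bij_betw (\<lambda>i. grid l r P (Suc i)) {..<card P} P"
  using bij_betw_nth[of "sorted_list_of_set P" "{..<card P}" P]
  by (subst bij_betw_cong[of _ _ "(!) (sorted_list_of_set P)"]) (auto simp: grid_Suc)

lemma grid_seq_grid:
  assumes "l < r" "finite P" "P \<subseteq> {l<..<r}"
  shows "grid_seq (grid l r P) (card P)"
proof -
  have "sorted_wrt (<) ([l] @ sorted_list_of_set P @ [r])"
    using assms by (auto simp: sorted_wrt_append)
  then have "([l] @ sorted_list_of_set P @ [r]) ! i < ([l] @ sorted_list_of_set P @ [r]) ! Suc i"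
    if "i \<le> card P" for i
    using that by (intro sorted_wrt_nth_less[where P="(<)"]) auto
  then show ?thesis unfolding grid_seq_def grid_def by blast
qed

text \<open>The exponents of the heat kernels add up to half the Dirichlet energy of
  \<open>v\<close>, the path of grid values completed by the boundary values at the indices
  \<open>0\<close> and \<open>Suc n\<close>.\<close>

lemma bridge_fdd_density_dirichlet:
  fixes v :: "nat \<Rightarrow> real"
  assumes "l < r" "finite P" "P \<subseteq> {l<..<r}"
  defines "n \<equiv> card P" and "p \<equiv> grid l r P"
  assumes v: "v 0 = a" "v (Suc n) = b" "\<And>i. i < n \<Longrightarrow> v (Suc i) = y (p (Suc i))"
  shows "bridge_fdd_density l r a b P y =
    (\<Prod>i\<le>n. 1 / sqrt (2 * pi * (p (Suc i) - p i))) / heat_kernel (r - l) (b - a)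
      * exp (- dirichlet p n v v / 2)"
proof -
  let ?vs = "[a] @ map y (sorted_list_of_set P) @ [b]"
  have vs: "?vs ! i = v i" if "i \<le> Suc n" for i
  proof -
    consider "i = 0" | "i = Suc n" | m where "m < n" "i = Suc m"
      using \<open>i \<le> Suc n\<close> by (cases i) (auto simp: le_less)
    then show ?thesis
      by cases (use v in \<open>auto simp: n_def p_def nth_append grid_Suc\<close>)
  qed
  have "bridge_fdd_density l r a b P y
      = (\<Prod>i\<le>n. heat_kernel (p (Suc i) - p i) (v (Suc i) - v i)) / heat_kernel (r - l) (b - a)"
  proof -
    have "(\<Prod>i<Suc n. heat_kernel (p (i+1) - p i) (?vs ! (i+1) - ?vs ! i))
        = (\<Prod>i<Suc n. heat_kernel (p (i+1) - p i) (v (i+1) - v i))"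
      using vs by (intro prod.cong refl) (simp del: append.simps)
    then show ?thesis
      by (simp only: bridge_fdd_density_def Let_def p_def grid_def[symmetric])
         (simp add: n_def lessThan_Suc_atMost[symmetric] del: prod.lessThan_Suc)
  qed
  also have "(\<Prod>i\<le>n. heat_kernel (p (Suc i) - p i) (v (Suc i) - v i))
      = (\<Prod>i\<le>n. 1 / sqrt (2 * pi * (p (Suc i) - p i)) * exp (- (slope p v i * (v (Suc i) - v i)) / 2))"
    by (intro prod.cong refl) (simp add: heat_kernel_def slope_def power2_eq_square)
  also have "\<dots> = (\<Prod>i\<le>n. 1 / sqrt (2 * pi * (p (Suc i) - p i))) * exp (- dirichlet p n v v / 2)"
    by (simp only: prod.distrib dirichlet_def exp_sum[symmetric] finite_atMost sum_negf sum_divide_distrib[symmetric])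
  finally show ?thesis by simp
qed

text \<open>The part of the density that does not depend on the grid values; it cancels from the
  conditional probability.\<close>

definition normalisation :: "nat \<Rightarrow> real \<Rightarrow> real \<Rightarrow> (nat \<Rightarrow> real) \<Rightarrow> (nat \<Rightarrow> real) \<Rightarrow> real set \<Rightarrow> real" where
  "normalisation k l r am ap P = (\<Prod>j\<in>{1..k}.
    (\<Prod>i\<le>card P. 1 / sqrt (2 * pi * (grid l r P (Suc i) - grid l r P i))) / heat_kernel (r - l) (ap j - am j))"

lemma normalisation_pos:
  assumes "l < r" "finite P" "P \<subseteq> {l<..<r}"
  shows "normalisation k l r am ap P > 0"
proof -
  have "0 < (\<Prod>i\<le>card P. 1 / sqrt (2 * pi * (grid l r P (Suc i) - grid l r P i)))"
    using grid_seq_grid[OF assms] by (intro prod_pos) (auto simp: grid_seq_def)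
  moreover have "0 < heat_kernel (r - l) c" for c using assms(1) by (simp add: heat_kernel_def)
  ultimately show ?thesis
    unfolding normalisation_def by (blast intro: prod_pos divide_pos_pos)
qed

lemma free_density_eq:
  fixes V :: "nat \<Rightarrow> nat \<Rightarrow> real"
  assumes "l < r" "finite P" "P \<subseteq> {l<..<r}"
  defines "n \<equiv> card P" and "p \<equiv> grid l r P"
  assumes V: "\<And>j. j \<in> {1..k} \<Longrightarrow> V j 0 = am j \<and> V j (Suc n) = ap j"
    "\<And>j i. j \<in> {1..k} \<Longrightarrow> i < n \<Longrightarrow> V j (Suc i) = x (j, p (Suc i))"
  shows "free_density k l r am ap P x
    = normalisation k l r am ap P * exp (- (\<Sum>j\<in>{1..k}. dirichlet p n (V j) (V j)) / 2)"
proof -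
  have "free_density k l r am ap P x
    = (\<Prod>j\<in>{1..k}. (\<Prod>i\<le>n. 1 / sqrt (2 * pi * (p (Suc i) - p i))) / heat_kernel (r - l) (ap j - am j)
        * exp (- dirichlet p n (V j) (V j) / 2))"
    unfolding free_density_def n_def p_def
    by (intro prod.cong refl bridge_fdd_density_dirichlet[OF assms(1-3)])
       (use V in \<open>auto simp: n_def p_def\<close>)
  also have "\<dots> = normalisation k l r am ap P * exp (\<Sum>j\<in>{1..k}. - dirichlet p n (V j) (V j) / 2)"
    by (simp only: prod.distrib exp_sum finite_atLeastAtMost normalisation_def n_def p_def)
  finally show ?thesis by (simp only: sum_negf sum_divide_distrib[symmetric])
qed

text \<open>The deviation of curve \<open>j\<close> from a reference profile: zero at both ends,
  because the profile carries the boundary values.\<close>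

definition curve :: "(nat \<Rightarrow> real) \<Rightarrow> nat \<Rightarrow> (nat \<times> real \<Rightarrow> real) \<Rightarrow> nat \<Rightarrow> nat \<Rightarrow> real" where
  "curve p n x j i = (if 0 < i \<and> i \<le> n then x (j, p i) else 0)"

text \<open>The exponent of the centred bridges: up to a constant, their joint density is
  \<open>exp (- energy k p n x)\<close>.\<close>

definition energy :: "nat \<Rightarrow> (nat \<Rightarrow> real) \<Rightarrow> nat \<Rightarrow> (nat \<times> real \<Rightarrow> real) \<Rightarrow> real" where
  "energy k p n x = (\<Sum>j\<in>{1..k}. dirichlet p n (curve p n x j) (curve p n x j)) / 2"

text \<open>Profiles are indexed by node number, configurations by points of \<open>P\<close>; the
  inverse of the enumeration of \<open>P\<close> translates between them.\<close>

definition config :: "(nat \<Rightarrow> real) \<Rightarrow> nat \<Rightarrow> (nat \<Rightarrow> nat \<Rightarrow> real) \<Rightarrow> nat \<times> real \<Rightarrow> real" where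
  "config p n U = (\<lambda>(j, z). U j (Suc (inv_into {..<n} (\<lambda>i. p (Suc i)) z)))"

lemma config_grid:
  assumes "inj_on (\<lambda>i. p (Suc i)) {..<n}" "i < n"
  shows "config p n U (j, p (Suc i)) = U j (Suc i)"
  using inv_into_f_f[OF assms(1), of i] assms(2) by (simp add: config_def)

text \<open>Expansion of the quadratic form around the profile \<open>U\<close>. The linear term
  stays separate: for the concave majorants its sign will matter, for the lifted profiles its
  size.\<close>

lemma free_density_dirichlet:
  fixes U :: "nat \<Rightarrow> nat \<Rightarrow> real"
  assumes "l < r" "finite P" "P \<subseteq> {l<..<r}"
  defines "n \<equiv> card P" and "p \<equiv> grid l r P"
  assumes U: "\<And>j. j \<in> {1..k} \<Longrightarrow> U j 0 = am j \<and> U j (Suc n) = ap j"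
  shows "free_density k l r am ap P (\<lambda>z\<in>{1..k} \<times> P. config p n U z + y z)
    = normalisation k l r am ap P * exp (- (\<Sum>j\<in>{1..k}. dirichlet p n (U j) (U j)) / 2
        - (\<Sum>j\<in>{1..k}. dirichlet p n (U j) (curve p n y j)) - energy k p n y)"
proof -
  have bij: "bij_betw (\<lambda>i. p (Suc i)) {..<n} P" using bij_betw_grid[OF assms(2)] by (simp add: n_def p_def)
  let ?V = "\<lambda>j i. U j i + curve p n y j i"
  have "free_density k l r am ap P (\<lambda>z\<in>{1..k} \<times> P. config p n U z + y z)
    = normalisation k l r am ap P * exp (- (\<Sum>j\<in>{1..k}. dirichlet p n (?V j) (?V j)) / 2)"
    unfolding n_def p_def
  proof (rule free_density_eq[OF assms(1-3)], fold n_def p_def)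
    fix i j assume j: "j \<in> {1..k}" and i: "i < n"
    then have "p (Suc i) \<in> P" using bij by (auto simp: bij_betw_def)
    then show "?V j (Suc i) = (\<lambda>z\<in>{1..k} \<times> P. config p n U z + y z) (j, p (Suc i))"
      using i j bij by (simp add: config_grid bij_betw_def curve_def)
  qed (use U in \<open>auto simp: curve_def\<close>)
  also have "- (\<Sum>j\<in>{1..k}. dirichlet p n (?V j) (?V j)) / 2
     = - (\<Sum>j\<in>{1..k}. dirichlet p n (U j) (U j)) / 2
        - (\<Sum>j\<in>{1..k}. dirichlet p n (U j) (curve p n y j)) - energy k p n y"
    by (simp only: dirichlet_square energy_def sum.distrib sum_distrib_left[symmetric]) (simp add: field_simps)
  finally show ?thesis .
qed

lemma energy_hom:
  assumes "bij_betw (\<lambda>i. p (Suc i)) {..<n} P"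
  shows "energy k p n (\<lambda>z\<in>{1..k} \<times> P. c * y z) = c\<^sup>2 * energy k p n y"
proof -
  have "curve p n (\<lambda>z\<in>{1..k} \<times> P. c * y z) j = (\<lambda>i. c * curve p n y j i)" if "j \<in> {1..k}" for j
  proof
    fix i
    have "p i \<in> P" if "0 < i" "i \<le> n"
      using assms that by (cases i) (auto simp: bij_betw_def)
    then show "curve p n (\<lambda>z\<in>{1..k} \<times> P. c * y z) j i = c * curve p n y j i"
      using that by (auto simp: curve_def)
  qed
  then show ?thesis by (simp add: energy_def dirichlet_scale sum_distrib_left)
qed

text \<open>A single curve carries at most the total energy, and the \<open>2\<close> undoes the
  half in \<open>energy\<close>. Both integrability of the Gaussian weight and the uniform bound on
  deviations come from this.\<close>

lemma square_le_energy:
  assumes "grid_seq p n" "j \<in> {1..k}" "i < n"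
  shows "(y (j, p (Suc i)))\<^sup>2 \<le> 2 * (p (Suc n) - p 0) * energy k p n y"
proof -
  have "p 0 < p (Suc n)" using grid_seq_less[OF assms(1), of 0 "Suc n"] by simp
  moreover have "dirichlet p n (curve p n y j) (curve p n y j) \<le> 2 * energy k p n y"
    using assms(2) by (auto simp: energy_def dirichlet_nonneg[OF assms(1)] intro!: member_le_sum)
  ultimately have "(p (Suc n) - p 0) * dirichlet p n (curve p n y j) (curve p n y j)
      \<le> (p (Suc n) - p 0) * (2 * energy k p n y)" by (intro mult_left_mono) auto
  moreover have "(curve p n y j (Suc i))\<^sup>2 \<le> (p (Suc n) - p 0) * dirichlet p n (curve p n y j) (curve p n y j)"
    using assms by (intro square_le_dirichlet) (auto simp: curve_def)
  ultimately show ?thesis using assms(3) by (simp only: curve_def) (simp add: algebra_simps)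
qed

lemma energy_nonneg: "grid_seq p n \<Longrightarrow> 0 \<le> energy k p n y"
  by (auto simp: energy_def dirichlet_nonneg intro!: sum_nonneg)

section \<open>Measurability of energies, densities and events\<close>

lemma measurable_energy:
  assumes "bij_betw (\<lambda>i. p (Suc i)) {..<n} P"
  shows "energy k p n \<in> borel_measurable (PiM ({1..k} \<times> P) (\<lambda>_. lborel))"
proof -
  have "(\<lambda>y. curve p n y j i) \<in> borel_measurable (PiM ({1..k} \<times> P) (\<lambda>_. lborel))" if j: "j \<in> {1..k}" for i j
  proof (cases "0 < i \<and> i \<le> n")
    case True
    then have "p i \<in> P" using assms by (cases i) (auto simp: bij_betw_def)
    then have "(\<lambda>y. y (j, p i)) \<in> measurable (PiM ({1..k} \<times> P) (\<lambda>_. lborel)) lborel"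
      using j by (intro measurable_component_singleton) auto
    then show ?thesis using True by (simp add: curve_def)
  qed (auto simp: curve_def)
  then show ?thesis
    unfolding energy_def dirichlet_def slope_def
    by (intro borel_measurable_divide borel_measurable_sum borel_measurable_times borel_measurable_diff) auto
qed

lemma measurable_free_density:
  assumes "l < r" "finite P" "P \<subseteq> {l<..<r}"
  shows "free_density k l r am ap P \<in> borel_measurable (PiM ({1..k} \<times> P) (\<lambda>_. lborel))"
proof -
  let ?p = "grid l r P" and ?n = "card P" and ?M = "PiM ({1..k} \<times> P) (\<lambda>_. lborel :: real measure)"
  have bij: "bij_betw (\<lambda>i. ?p (Suc i)) {..<?n} P" by (rule bij_betw_grid[OF assms(2)])
  define V where "V j x i = (if i = 0 then am j else if i = Suc ?n then ap j else x (j, ?p i))" for j x i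
  have V: "(\<lambda>x. V j x i) \<in> borel_measurable ?M" if j: "j \<in> {1..k}" and i: "i \<le> Suc ?n" for i j
  proof (cases "i = 0 \<or> i = Suc ?n")
    case False
    then have "?p i \<in> P" using bij i by (cases i) (auto simp: bij_betw_def le_less)
    then have "(\<lambda>y. y (j, ?p i)) \<in> measurable ?M lborel"
      using j by (intro measurable_component_singleton) auto
    then show ?thesis using False by (simp add: V_def)
  qed (auto simp: V_def)
  have eq: "free_density k l r am ap P = (\<lambda>x. normalisation k l r am ap P
      * exp (- (\<Sum>j\<in>{1..k}. dirichlet ?p ?n (V j x) (V j x)) / 2))"
    by (rule ext, rule free_density_eq[OF assms]) (auto simp: V_def)
  have "(\<lambda>x. dirichlet ?p ?n (V j x) (V j x)) \<in> borel_measurable ?M" if "j \<in> {1..k}" for j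
    unfolding dirichlet_def slope_def using V[OF that]
    by (intro borel_measurable_divide borel_measurable_sum borel_measurable_times borel_measurable_diff) auto
  then show ?thesis
    unfolding eq by measurable
qed

lemma free_density_nonneg:
  assumes "l < r" "finite P" "P \<subseteq> {l<..<r}"
  shows "0 \<le> free_density k l r am ap P x"
proof -
  define V where "V j i = (if i = 0 then am j else if i = Suc (card P) then ap j
    else x (j, grid l r P i))" for j i
  have "free_density k l r am ap P x = normalisation k l r am ap P
      * exp (- (\<Sum>j\<in>{1..k}. dirichlet (grid l r P) (card P) (V j) (V j)) / 2)"
    by (rule free_density_eq[OF assms]) (auto simp: V_def)
  then show ?thesis using normalisation_pos[OF assms, of k am ap] by simp
qed

lemma measurable_above_event:
  assumes "finite P"
  shows "Measurable.pred (PiM ({1..k} \<times> P) (\<lambda>_. lborel)) (above_event k g P)"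
proof -
  have [measurable]: "(\<lambda>x. x (j, q)) \<in> borel_measurable (PiM ({1..k} \<times> P) (\<lambda>_. lborel :: real measure))"
    if "j \<in> {1..k}" "q \<in> P" for j q
    using measurable_component_singleton[of "(j, q)" "{1..k} \<times> P" "\<lambda>_. lborel :: real measure"] that by simp
  show ?thesis unfolding above_event_def[abs_def] using assms
    by (intro pred_intros_finite pred_intros_logic) measurable
qed

lemma measurable_H_event:
  assumes "finite P" "k \<ge> 1"
  shows "Measurable.pred (PiM ({1..k} \<times> P) (\<lambda>_. lborel)) (H_event k \<mu> lam0 lam1 T g P)"
proof -
  have m: "(\<lambda>x. x (j, q)) \<in> borel_measurable (PiM ({1..k} \<times> P) (\<lambda>_. lborel :: real measure))"
    if "j \<in> {1..k}" "q \<in> P" for j q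
    using measurable_component_singleton[of "(j, q)" "{1..k} \<times> P" "\<lambda>_. lborel :: real measure"] that by simp
  have pred: "Measurable.pred (PiM ({1..k} \<times> P) (\<lambda>_. lborel)) (\<lambda>x. c \<le> f x)"
    if [measurable]: "f \<in> borel_measurable (PiM ({1..k} \<times> P) (\<lambda>_. lborel :: real measure))"
    for f and c :: real
    by measurable
  have 1: "Measurable.pred (PiM ({1..k} \<times> P) (\<lambda>_. lborel)) (\<lambda>x. c \<le> x (j, q) - x (j + 1, q))"
    if "j \<in> {1..<k}" "q \<in> P" for j q and c :: real
    using that by (intro pred borel_measurable_diff m) auto
  have 2: "Measurable.pred (PiM ({1..k} \<times> P) (\<lambda>_. lborel)) (\<lambda>x. c \<le> x (k, q) - g q)"
    if "q \<in> P" for q c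
    using that assms(2) by (intro pred borel_measurable_diff m) auto
  show ?thesis unfolding H_event_def[abs_def] using assms 1 2
    by (intro pred_intros_finite pred_intros_logic) auto
qed

subsection \<open>The lower bound\<close>

text \<open>Target profiles: the least concave majorants \<open>f j\<close>, lifted by multiples of one tent \<open>h\<close> whose
  slope near the ends makes up for the gap lost by \<open>f\<close> there.\<close>
lemma conditioned_bridges_lower_bound:
  fixes T l r \<mu> lam0 lam1 b0 b1 \<kappa> w :: real and am ap :: "nat \<Rightarrow> real" and g :: "real \<Rightarrow> real"
  assumes k: "k \<ge> 1" and const: "b0 > 0" "b1 > 0" "lam0 > 0" "lam1 > 0" "0 < \<mu>" "\<mu> < 1"
    and T: "T \<ge> 1" and lr: "l < r" and P: "finite P" "P \<subseteq> {l<..<r}"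
    and g0: "g l = 0" "g r = 0" and len: "r - l \<le> b0 * T"
    and lip: "\<And>x y. x \<in> {l..r} \<Longrightarrow> y \<in> {l..r} \<Longrightarrow> \<bar>g x - g y\<bar> \<le> b1 * T * \<bar>x - y\<bar>"
    and gap: "\<And>j. j \<in> {1..<k} \<Longrightarrow> am j - am (j+1) \<ge> lam0 * T powr (1/2) \<and> ap j - ap (j+1) \<ge> lam0 * T powr (1/2)"
    and bot: "am k \<ge> lam1 * T" "ap k \<ge> lam1 * T"
    and \<kappa>: "0 < \<kappa>" "\<kappa> \<le> 2 * real (k * card P) + 2" "2 * (b0 * T) * \<kappa> \<le> w\<^sup>2"
    and w: "w > 0" "2 * w \<le> (1 - \<mu>) * lam0 * T powr (1/2)" "w \<le> (1 - \<mu>) * lam1 * T"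
  defines "A \<equiv> (lam0 + lam1) * T" and "B \<equiv> b1 * T"
  shows "cond_prob_H k l r am ap g P \<mu> lam0 lam1 T
    \<ge> exp (- (real k * (2 * real k * B * A + 2 * (real k)\<^sup>2 * B * A + (2 * B + 4 * real k * B) * w)))
      * (sqrt (\<kappa> / (2 * real (k * card P) + 2)) ^ (k * card P) / 2)"
proof -
  define n where "n = card P"
  define p where "p = grid l r P"
  define S where "S = T powr (1/2)"
  let ?I = "{1..k} \<times> P"
  let ?M = "PiM ?I (\<lambda>_. lborel :: real measure)"
  let ?q = "energy k p n"
  have A: "A > 0" and B: "B > 0" using const T by (auto simp: A_def B_def)
  have S: "S > 0" "S \<le> T"
    using T powr_mono[of "1/2" 1 T] by (auto simp: S_def)
  have grid: "grid_seq p n" unfolding p_def n_def by (rule grid_seq_grid[OF lr P])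
  have bij: "bij_betw (\<lambda>i. p (Suc i)) {..<n} P" using bij_betw_grid[OF P(1)] by (simp add: p_def n_def)
  have ends: "p 0 = l" "p (Suc n) = r" by (simp_all add: p_def n_def grid_0 grid_last)
  have pP: "p (Suc i) \<in> P" "l < p (Suc i)" "p (Suc i) < r" if "i < n" for i
    using bij that P by (auto simp: bij_betw_def)
  have gL: "g (p (Suc i)) \<le> B * (p (Suc i) - p 0)" if "i < n" for i
    using lip[of "p (Suc i)" l] pP[OF that] g0 by (auto simp: ends B_def)
  have gR: "g (p (Suc i)) \<le> B * (p (Suc n) - p (Suc i))" if "i < n" for i
    using lip[of "p (Suc i)" r] pP[OF that] g0 by (auto simp: ends B_def)
  \<comment> \<open>Descending induction from the bottom curve \<open>k\<close>, since all gaps are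
    nonnegative.\<close>
  have amk: "lam1 * T \<le> am j \<and> lam1 * T \<le> ap j" if "j \<in> {1..k}" for j
  proof -
    from that have "j \<le> k" by simp
    then show ?thesis using that
    proof (induction rule: inc_induct)
      case (step m)
      have "0 \<le> lam0 * T powr (1/2)" using const by simp
      then show ?case using step gap[of m] by auto
    qed (use bot in auto)
  qed

  \<comment> \<open>Least concave majorants with the boundary values of each curve\<close>
  define G where "G j i = (if i = 0 then am j else if i = Suc n then ap j else g (p i))" for j i
  \<comment> \<open>All properties are gathered in one predicate so that a single choice yields the
    whole family \<open>f\<close>.\<close>
  let ?P = "\<lambda>j u. u 0 = G j 0 \<and> u (Suc n) = G j (Suc n) \<and> concave_seq p n u
    \<and> (\<forall>i\<le>Suc n. G j i \<le> u i)
    \<and> (\<forall>i<n. slope p u (Suc i) < slope p u i \<longrightarrow> u (Suc i) = G j (Suc i))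
    \<and> (\<forall>h. concave_seq p n h \<longrightarrow> (\<forall>i\<le>Suc n. G j i \<le> h i) \<longrightarrow> (\<forall>i\<le>Suc n. u i \<le> h i))
    \<and> slope p u 0 - slope p u n \<le> 2 * B
    \<and> (\<forall>i\<le>Suc n. u i \<le> interp p n (G j 0) (G j (Suc n)) i
        + 2 * B * min (p i - p 0) (p (Suc n) - p i))"
  have "\<forall>j\<in>{1..k}. \<exists>u. ?P j u"
  proof
    fix j assume j: "j \<in> {1..k}"
    have "0 \<le> lam1 * T" using const T by simp
    then have "0 \<le> G j 0" "0 \<le> G j (Suc n)" using amk[OF j] by (auto simp: G_def)
    moreover have "G j (Suc i) \<le> B * (p (Suc i) - p 0)" "G j (Suc i) \<le> B * (p (Suc n) - p (Suc i))"
      if "i < n" for i using gL gR that by (auto simp: G_def)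
    ultimately show "\<exists>u. ?P j u"
    proof (rule least_concave_majorant_lipschitz[OF grid less_imp_le[OF B]], goal_cases)
      case (3 u)
      then show ?case
        by (intro exI[of _ u] conjI allI impI) simp_all
    qed
  qed
  from bchoice[OF this] obtain f where "\<forall>j\<in>{1..k}. ?P j (f j)" by (elim exE)
  then have f: "?P j (f j)" if "j \<in> {1..k}" for j using that by (rule bspec)
  have fends: "f j 0 = am j" "f j (Suc n) = ap j" if "j \<in> {1..k}" for j
    using f[OF that, THEN conjunct1] f[OF that, THEN conjunct2, THEN conjunct1] by (simp_all add: G_def)
  have fconc: "concave_seq p n (f j)" if "j \<in> {1..k}" for j
    using f[OF that] by (elim conjE)
  have fge: "G j i \<le> f j i" if "j \<in> {1..k}" "i \<le> Suc n" for i j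
    using f[OF that(1)] that(2) by (elim conjE) (rule allE[of _ i], assumption, erule mp)
  have fcontact: "f j (Suc i) = g (p (Suc i))"
    if "j \<in> {1..k}" "i < n" "slope p (f j) (Suc i) < slope p (f j) i" for i j
  proof -
    have "f j (Suc i) = G j (Suc i)" using f[OF that(1)] that(2,3) by (elim conjE) blast
    then show ?thesis using that(2) by (simp add: G_def)
  qed
  have fmin: "f j i \<le> v i"
    if "j \<in> {1..k}" "concave_seq p n v" "\<And>i. i \<le> Suc n \<Longrightarrow> G j i \<le> v i" "i \<le> Suc n" for i j v
    using f[OF that(1)] that(2-) by (elim conjE) blast
  have fbend: "slope p (f j) 0 - slope p (f j) n \<le> 2 * B" if "j \<in> {1..k}" for j
    using f[OF that] by (elim conjE)
  have fdist: "f j i \<le> interp p n (am j) (ap j) i + 2 * B * min (p i - p 0) (p (Suc n) - p i)"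
    if "j \<in> {1..k}" "i \<le> Suc n" for i j
  proof -
    have "f j i \<le> interp p n (G j 0) (G j (Suc n)) i + 2 * B * min (p i - p 0) (p (Suc n) - p i)"
      using f[OF that(1)] that(2) by (elim conjE) blast
    then show ?thesis by (simp add: G_def)
  qed

  \<comment> \<open>The tent and the lifted profiles\<close>
  define h where "h i = min A ((2 * B) * min (p i - p 0) (p (Suc n) - p i))" for i
  \<comment> \<open>The slope \<open>2 * B\<close> matches the excess of \<open>f j\<close> over its
    interpolation in \<open>fdist\<close> and also beats the slope \<open>B\<close> of the obstacle.
    The height \<open>A\<close> exceeds both required separations, \<open>lam1 * T\<close> and
    \<open>lam0 * S\<close>.\<close>
  have h: "concave_seq p n h" "h 0 = 0" "h (Suc n) = 0" "slope p h 0 - slope p h n \<le> 4 * B"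
    "\<And>i. i \<le> Suc n \<Longrightarrow> 0 \<le> h i" "\<And>i. h i \<le> A"
    using concave_tent[OF grid, of "2 * B" A] A B by (auto simp: h_def[abs_def])
  \<comment> \<open>The bottom curve is lifted by one tent, and each curve by one tent more than the
    curve below it.\<close>
  define c where "c j = real (Suc k - j)" for j
  have c: "1 \<le> c j" "c j \<le> k" if "j \<in> {1..k}" for j using that by (auto simp: c_def)
  have cS: "c j = c (j + 1) + 1" if "j \<in> {1..<k}" for j using that by (auto simp: c_def)
  define U where "U j i = f j i + c j * h i" for j i
  have bdry: "f j 0 = am j" "f j (Suc n) = ap j" "U j 0 = am j" "U j (Suc n) = ap j"
    if "j \<in> {1..k}" for j using fends[OF that] h by (auto simp: U_def)
  have tent: "h (Suc i) = A \<or> h (Suc i) = 2 * B * min (p (Suc i) - p 0) (p (Suc n) - p (Suc i))" for i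
    by (auto simp: h_def min_def)
  have fint: "interp p n (am j) (ap j) i \<le> f j i" if "j \<in> {1..k}" "i \<le> Suc n" for i j
    using concave_seq_ge_interp[OF grid fconc[OF that(1)] that(2)] fends[OF that(1)] by simp
  \<comment> \<open>On the plateau \<open>f j\<close> clears \<open>g\<close> and the tent supplies
    the margin; on the slopes the tent clears \<open>g\<close> and \<open>f j\<close>, being above
    its interpolation, supplies the margin.\<close>
  have Ubot: "lam1 * T \<le> U j (Suc i) - g (p (Suc i))" if j: "j \<in> {1..k}" and i: "i < n" for i j
  proof -
    have 1: "lam1 * T \<le> f j (Suc i)"
      using fint[OF j, of "Suc i"] interp_ge[OF grid, of "Suc i" "lam1 * T" "am j" "ap j"] amk[OF j] i by auto
    have 2: "g (p (Suc i)) \<le> f j (Suc i)"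
      using fge[OF j, of "Suc i"] i by (simp add: G_def)
    have 3: "h (Suc i) \<le> c j * h (Suc i)"
      using mult_right_mono[OF c(1)[OF j] h(5)[of "Suc i"]] i by simp
    from tent[of i] show ?thesis
    proof
      assume "h (Suc i) = A"
      moreover have "lam1 * T \<le> A" using const T by (simp add: A_def algebra_simps)
      ultimately show ?thesis using 2 3 by (simp add: U_def)
    next
      assume h: "h (Suc i) = 2 * B * min (p (Suc i) - p 0) (p (Suc n) - p (Suc i))"
      have "g (p (Suc i)) \<le> B * min (p (Suc i) - p 0) (p (Suc n) - p (Suc i))"
        using gL[OF i] gR[OF i] by (auto simp: min_def)
      also have "\<dots> \<le> h (Suc i)"
        unfolding h using B pP[OF i] by (intro mult_right_mono) (auto simp: ends)
      finally show ?thesis using 1 3 by (simp add: U_def)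
    qed
  qed
  \<comment> \<open>On the plateau the additional tent supplies the gap. On the slopes the gap is
    that of the interpolations, and the tent pays for the excess of \<open>f (j + 1)\<close> over
    its own interpolation.\<close>
  have Ugap: "lam0 * S \<le> U j (Suc i) - U (j + 1) (Suc i)" if j: "j \<in> {1..<k}" and i: "i < n" for i j
  proof -
    have j': "j \<in> {1..k}" "j + 1 \<in> {1..k}" using j by auto
    have "0 \<le> lam0 * S" using const S by simp
    then have "G (j + 1) m \<le> G j m" for m
      using gap[OF j] by (auto simp: G_def S_def)
    then have "G (j + 1) m \<le> f j m" if "m \<le> Suc n" for m
      using fge[OF j'(1) that] order_trans by blast
    \<comment> \<open>\<open>f j\<close> is a concave majorant of the lower data
      \<open>G (j + 1)\<close>, so minimality of \<open>f (j + 1)\<close> orders the two.\<close>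
    then have ff: "f (j + 1) (Suc i) \<le> f j (Suc i)"
      using i by (intro fmin[OF j'(2) fconc[OF j'(1)]]) auto
    have UU: "U j (Suc i) - U (j + 1) (Suc i) = f j (Suc i) - f (j + 1) (Suc i) + h (Suc i)"
      unfolding U_def cS[OF j] by (simp add: algebra_simps)
    from tent[of i] show ?thesis
    proof
      assume "h (Suc i) = A"
      moreover have "lam0 * S \<le> lam0 * T" using S const by simp
      moreover have "lam0 * T \<le> A" using const T by (simp add: A_def algebra_simps)
      ultimately show ?thesis using ff UU by simp
    next
      assume hh: "h (Suc i) = 2 * B * min (p (Suc i) - p 0) (p (Suc n) - p (Suc i))"
      have "lam0 * S \<le> interp p n (am j) (ap j) (Suc i) - interp p n (am (j+1)) (ap (j+1)) (Suc i)"
        unfolding interp_diff using gap[OF j] i by (intro interp_ge[OF grid]) (auto simp: S_def)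
      moreover have "f (j+1) (Suc i) \<le> interp p n (am (j+1)) (ap (j+1)) (Suc i) + h (Suc i)"
        using fdist[OF j'(2), of "Suc i"] i by (simp add: hh)
      ultimately show ?thesis using fint[OF j'(1), of "Suc i"] UU i by auto
    qed
  qed
  have small: "\<bar>y (j, p (Suc i))\<bar> \<le> w" if "?q y \<le> \<kappa>" "j \<in> {1..k}" "i < n" for y i j
  proof -
    have "(y (j, p (Suc i)))\<^sup>2 \<le> 2 * (r - l) * ?q y"
      using square_le_energy[OF grid that(2,3), of y] by (simp add: ends)
    also have "\<dots> \<le> 2 * (b0 * T) * \<kappa>"
      using that(1) lr len const T energy_nonneg[OF grid, of k y] by (intro mult_mono) auto
    also have "\<dots> \<le> w\<^sup>2" by (rule \<kappa>)
    finally show ?thesis using w(1) abs_le_square_iff[of "y (j, p (Suc i))" w] by simp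
  qed

  \<comment> \<open>Densities around the majorants and around the lifted profiles\<close>
  let ?K = "normalisation k l r am ap P"
  have K: "?K > 0" by (rule normalisation_pos[OF lr P])
  let ?F = "free_density k l r am ap P"
  have dens: "?F (\<lambda>z\<in>?I. config p n V z + y z)
    = ?K * exp (- (\<Sum>j\<in>{1..k}. dirichlet p n (V j) (V j)) / 2
        - (\<Sum>j\<in>{1..k}. dirichlet p n (V j) (curve p n y j)) - ?q y)"
    if "\<And>j. j \<in> {1..k} \<Longrightarrow> V j 0 = am j \<and> V j (Suc n) = ap j" for V y
    unfolding p_def n_def by (rule free_density_dirichlet[OF lr P]) (use that in \<open>auto simp: n_def\<close>)
  have cfg: "(\<lambda>z\<in>?I. config p n V z + y z) (j, p (Suc i)) = V j (Suc i) + y (j, p (Suc i))"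
    if "j \<in> {1..k}" "i < n" for V y i j
    using that bij pP by (simp add: config_grid bij_betw_def)
  \<comment> \<open>Bound for the linear term summed over \<open>k\<close> curves: bending
    \<open>2 * B\<close> from \<open>f j\<close> and \<open>4 * B\<close> from each of at most
    \<open>k\<close> tents, times the deviation \<open>w\<close>.\<close>
  let ?D = "real k * ((2 * B + 4 * real k * B) * w)"
  let ?c0 = "?K * exp (- (\<Sum>j\<in>{1..k}. dirichlet p n (f j) (f j)) / 2)"
  let ?c1 = "?K * exp (- (\<Sum>j\<in>{1..k}. dirichlet p n (U j) (U j)) / 2 - ?D)"
  let ?A = "{x. above_event k g P x}"
  let ?H = "{x. above_event k g P x \<and> H_event k \<mu> lam0 lam1 T g P x}"
  have dfU: "dirichlet p n (U j) v = dirichlet p n (f j) v + c j * dirichlet p n h v" for j v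
    unfolding U_def by (simp add: dirichlet_add_left dirichlet_scale_left)
  \<comment> \<open>By parts, the linear term is a sum of bends times deviations. A positive bend
    occurs only where \<open>f j\<close> meets \<open>g\<close>, and there a configuration above
    \<open>g\<close> has positive deviation.\<close>
  have up: "?F (\<lambda>z\<in>?I. config p n f z + y z) \<le> ?c0 * exp (- ?q y)"
    if "(\<lambda>z\<in>?I. config p n f z + y z) \<in> ?A" for y
  proof -
    have "0 \<le> dirichlet p n (f j) (curve p n y j)" if j: "j \<in> {1..k}" for j
    proof -
      have "0 \<le> (slope p (f j) i - slope p (f j) (Suc i)) * curve p n y j (Suc i)" if i: "i < n" for i
      proof (cases "slope p (f j) (Suc i) < slope p (f j) i")
        case True
        then have "f j (Suc i) = g (p (Suc i))" by (rule fcontact[OF j i])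
        moreover have "g (p (Suc i)) < (\<lambda>z\<in>?I. config p n f z + y z) (j, p (Suc i))"
          using \<open>_ \<in> ?A\<close> j pP(1)[OF i] unfolding above_event_def by blast
        ultimately have "0 < y (j, p (Suc i))" using cfg[OF j i, of f y] by simp
        then show ?thesis using True i by (simp add: curve_def)
      next
        case False
        moreover have "slope p (f j) (Suc i) \<le> slope p (f j) i" using fconc[OF j] i by (auto simp: concave_seq_def)
        ultimately show ?thesis by simp
      qed
      then show ?thesis by (subst dirichlet_by_parts) (auto simp: curve_def intro!: sum_nonneg)
    qed
    then have "0 \<le> (\<Sum>j\<in>{1..k}. dirichlet p n (f j) (curve p n y j))" by (intro sum_nonneg)
    then have "?F (\<lambda>z\<in>?I. config p n f z + y z)
        \<le> ?K * exp (- (\<Sum>j\<in>{1..k}. dirichlet p n (f j) (f j)) / 2 - ?q y)"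
      using K bdry by (subst dens) auto
    then show ?thesis by (simp add: mult.assoc exp_add[symmetric])
  qed
  \<comment> \<open>A gap between curves can lose two deviations and the distance to
    \<open>g\<close> only one, hence \<open>2 * w\<close> in one hypothesis on \<open>w\<close> and
    \<open>w\<close> in the other.\<close>
  have low: "(\<lambda>z\<in>?I. config p n U z + y z) \<in> ?H
      \<and> ?c1 * exp (- ?q y) \<le> ?F (\<lambda>z\<in>?I. config p n U z + y z)" if q: "?q y \<le> \<kappa>" for y
  proof
    let ?x = "\<lambda>z\<in>?I. config p n U z + y z"
    have ex: "\<exists>i<n. s = p (Suc i)" if "s \<in> P" for s using bij that by (auto simp: bij_betw_def)
    have bound: "\<mu> * lam1 * T \<le> ?x (j, s) - g s" if j: "j \<in> {1..k}" and s: "s \<in> P" for j s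
    proof -
      obtain i where i: "i < n" "s = p (Suc i)" using ex[OF s] by blast
      have "?x (j, s) = U j (Suc i) + y (j, s)" unfolding i(2) by (rule cfg[OF j i(1)])
      then show ?thesis using Ubot[OF j i(1)] small[OF q j i(1)] w(3) i(2) by (simp add: algebra_simps)
    qed
    have bound': "\<mu> * lam0 * T powr (1/2) \<le> ?x (j, s) - ?x (j+1, s)" if j: "j \<in> {1..<k}" and s: "s \<in> P" for j s
    proof -
      have j': "j \<in> {1..k}" "j + 1 \<in> {1..k}" using j by auto
      obtain i where i: "i < n" "s = p (Suc i)" using ex[OF s] by blast
      have "?x (j, s) = U j (Suc i) + y (j, s)" "?x (j+1, s) = U (j+1) (Suc i) + y (j+1, s)"
        unfolding i(2) by (rule cfg[OF _ i(1)], use j' in simp)+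
      then show ?thesis using Ugap[OF j i(1)] small[OF q j'(1) i(1)] small[OF q j'(2) i(1)] w(2) i(2)
        by (simp add: algebra_simps S_def)
    qed
    have "0 < \<mu> * lam1 * T" using const T by simp
    then show "?x \<in> ?H"
      using bound bound' k unfolding above_event_def H_event_def mem_Collect_eq
      by (intro conjI ballI) (fastforce simp del: restrict_apply)+
    have "dirichlet p n (U j) (curve p n y j) \<le> (2 * B + 4 * real k * B) * w" if j: "j \<in> {1..k}" for j
    proof -
      have cw: "\<bar>curve p n y j (Suc i)\<bar> \<le> w" if "i < n" for i
        using small[OF q j that] that by (simp add: curve_def)
      have "\<bar>dirichlet p n (f j) (curve p n y j)\<bar> \<le> (slope p (f j) 0 - slope p (f j) n) * w"
        using fconc[OF j] cw by (intro dirichlet_bound) (auto simp: curve_def)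
      also have "\<dots> \<le> 2 * B * w" using fbend[OF j] w(1) by (intro mult_right_mono) auto
      finally have 1: "dirichlet p n (f j) (curve p n y j) \<le> 2 * B * w" by simp
      have "\<bar>dirichlet p n h (curve p n y j)\<bar> \<le> (slope p h 0 - slope p h n) * w"
        using h(1) cw by (intro dirichlet_bound) (auto simp: curve_def)
      also have "\<dots> \<le> 4 * B * w" using h(4) w(1) by (intro mult_right_mono) auto
      finally have "dirichlet p n h (curve p n y j) \<le> 4 * B * w" by simp
      then have "c j * dirichlet p n h (curve p n y j) \<le> c j * (4 * B * w)"
        using c[OF j] by (intro mult_left_mono) auto
      also have "\<dots> \<le> real k * (4 * B * w)" using c[OF j] B w(1) by (intro mult_right_mono) auto
      finally show ?thesis using 1 unfolding dfU by (simp add: algebra_simps)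
    qed
    then have "(\<Sum>j\<in>{1..k}. dirichlet p n (U j) (curve p n y j)) \<le> ?D"
      using sum_bounded_above[of "{1..k}" "\<lambda>j. dirichlet p n (U j) (curve p n y j)"] by simp
    then have "?K * exp (- (\<Sum>j\<in>{1..k}. dirichlet p n (U j) (U j)) / 2 - ?D - ?q y) \<le> ?F ?x"
      using K bdry by (subst dens) auto
    then show "?c1 * exp (- ?q y) \<le> ?F ?x" by (simp add: mult.assoc exp_add[symmetric])
  qed

  \<comment> \<open>Energy cost of the lift\<close>
  have gain: "dirichlet p n (U j) (U j) / 2 \<le> dirichlet p n (f j) (f j) / 2
      + (2 * real k * B * A + 2 * (real k)\<^sup>2 * B * A)" if j: "j \<in> {1..k}" for j
  proof -
    have hA: "\<bar>h (Suc i)\<bar> \<le> A" if "i < n" for i using h(5)[of "Suc i"] h(6)[of "Suc i"] that by auto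
    have "\<bar>dirichlet p n (f j) h\<bar> \<le> (slope p (f j) 0 - slope p (f j) n) * A"
      using fconc[OF j] hA h by (intro dirichlet_bound) auto
    also have "\<dots> \<le> 2 * B * A" using fbend[OF j] A by (intro mult_right_mono) auto
    finally have 1: "dirichlet p n (f j) h \<le> 2 * B * A" by simp
    have "\<bar>dirichlet p n h h\<bar> \<le> (slope p h 0 - slope p h n) * A"
      using hA h by (intro dirichlet_bound) auto
    also have "\<dots> \<le> 4 * B * A" using h(4) A by (intro mult_right_mono) auto
    finally have 2: "dirichlet p n h h \<le> 4 * B * A" by simp
    have "dirichlet p n (U j) (U j)
        = dirichlet p n (f j) (f j) + 2 * (c j * dirichlet p n (f j) h) + (c j)\<^sup>2 * dirichlet p n h h"
      unfolding U_def by (simp add: dirichlet_square dirichlet_scale dirichlet_scale_right)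
    moreover have "c j * dirichlet p n (f j) h \<le> real k * (2 * B * A)"
    proof -
      have "c j * dirichlet p n (f j) h \<le> c j * (2 * B * A)" using 1 c[OF j] by (intro mult_left_mono) auto
      also have "\<dots> \<le> real k * (2 * B * A)" using c[OF j] A B by (intro mult_right_mono) auto
      finally show ?thesis .
    qed
    moreover have "(c j)\<^sup>2 * dirichlet p n h h \<le> (real k)\<^sup>2 * (4 * B * A)"
      using 2 c[OF j] dirichlet_nonneg[OF grid] by (intro mult_mono power_mono) auto
    ultimately show ?thesis by (simp add: algebra_simps)
  qed
  have "(\<Sum>j\<in>{1..k}. dirichlet p n (U j) (U j) / 2) \<le> (\<Sum>j\<in>{1..k}. dirichlet p n (f j) (f j) / 2
      + (2 * real k * B * A + 2 * (real k)\<^sup>2 * B * A))"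
    using gain by (rule sum_mono)
  then have energy_bound: "(\<Sum>j\<in>{1..k}. dirichlet p n (U j) (U j)) / 2 \<le> (\<Sum>j\<in>{1..k}. dirichlet p n (f j) (f j)) / 2
      + real k * (2 * real k * B * A + 2 * (real k)\<^sup>2 * B * A)"
    by (simp only: sum.distrib sum_divide_distrib[symmetric]) (simp add: algebra_simps)
  \<comment> \<open>The normalisation and the energy of the majorants cancel, so only the cost of
    the lift and the linear term remain.\<close>
  then have ratio: "exp (- (real k * (2 * real k * B * A + 2 * (real k)\<^sup>2 * B * A + (2 * B + 4 * real k * B) * w)))
      \<le> ?c1 / ?c0"
  proof -
    have "?c1 / ?c0 = exp (- (\<Sum>j\<in>{1..k}. dirichlet p n (U j) (U j)) / 2 - ?D
        - (- (\<Sum>j\<in>{1..k}. dirichlet p n (f j) (f j)) / 2))"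
      using K by (simp only: exp_diff mult_divide_mult_cancel_left)
    with energy_bound show ?thesis by (simp only: exp_le_cancel_iff distrib_left)
  qed

  \<comment> \<open>Measurability, integrability and conclusion\<close>
  have meas_q: "?q \<in> borel_measurable ?M" by (rule measurable_energy[OF bij])
  have nn: "0 \<le> ?q y" for y by (rule energy_nonneg[OF grid])
  have int: "integrable ?M (\<lambda>x. exp (- ?q x))"
  proof (rule integrable_exp_neg_quadratic[where \<epsilon> = "1 / (2 * (r - l))"])
    fix x z assume "z \<in> ?I"
    then obtain j i where *: "j \<in> {1..k}" "i < n" "z = (j, p (Suc i))" using bij by (auto simp: bij_betw_def)
    show "1 / (2 * (r - l)) * (x z)\<^sup>2 \<le> ?q x"
      using square_le_energy[OF grid *(1,2), of x] lr * by (simp add: ends field_simps)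
  qed (use P lr meas_q nn in auto)
  have mA: "(\<lambda>x. indicator ?A x :: real) \<in> borel_measurable ?M"
    using measurable_above_event[OF P(1), of k g] by measurable
  have mH: "(\<lambda>x. indicator ?H x :: real) \<in> borel_measurable ?M"
    using measurable_above_event[OF P(1), of k g] measurable_H_event[OF P(1) k, of \<mu> lam0 lam1 T g] by measurable
  have cI: "card ?I = k * card P" by (simp add: card_cartesian_product)
  have "?c1 / ?c0 * (sqrt (\<kappa> / (2 * real (card ?I) + 2)) ^ card ?I / 2)
      \<le> (LINT x|?M. ?F x * indicator ?H x) / (LINT x|?M. ?F x * indicator ?A x)"
  proof (rule conditioned_gaussian_lower_bound[where q = ?q and \<kappa> = \<kappa> and ?m0.0 = "config p n f" and ?m1.0 = "config p n U"])
    show "?F \<in> borel_measurable ?M" by (rule measurable_free_density[OF lr P])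
    show "0 \<le> ?F x" for x by (rule free_density_nonneg[OF lr P])
    show "?q (\<lambda>i\<in>?I. c * x i) = c\<^sup>2 * ?q x" for c x by (rule energy_hom[OF bij])
  qed (use P meas_q mA mH nn int \<kappa> cI K up low in auto)
  also have "\<dots> = cond_prob_H k l r am ap g P \<mu> lam0 lam1 T"
    by (simp add: cond_prob_H_def free_expectation_def grid_space_def)
  finally have "?c1 / ?c0 * (sqrt (\<kappa> / (2 * real (k * card P) + 2)) ^ (k * card P) / 2)
      \<le> cond_prob_H k l r am ap g P \<mu> lam0 lam1 T" by (simp only: cI)
  moreover have "0 \<le> sqrt (\<kappa> / (2 * real (k * card P) + 2)) ^ (k * card P) / 2" using \<kappa>(1) by simp
  ultimately show ?thesis using mult_right_mono[OF ratio] by (meson order_trans)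
qed

theorem mainTheorem2:
  fixes k :: nat and b0 b1 b2 lam0 lam1 \<mu> :: real
  assumes "k \<ge> 1"
    and "b0 > 0" "b1 > 0" "b2 > 0" "lam0 > 0" "lam1 > 0"
    and "0 < \<mu>" "\<mu> < 1"
  shows "\<exists>C>0. \<forall>T l r (am :: nat \<Rightarrow> real) (ap :: nat \<Rightarrow> real) (g :: real \<Rightarrow> real) (P :: real set).
    T \<ge> 10 \<and> l < r \<and> finite P \<and> P \<subseteq> {l<..<r}
    \<and> g l = 0 \<and> g r = 0
    \<and> r - l \<le> b0 * T \<and> real (card P) \<le> b0 * T
    \<and> (\<forall>x\<in>{l..r}. \<forall>y\<in>{l..r}. \<bar>g x - g y\<bar> \<le> b1 * T * \<bar>x - y\<bar>)
    \<and> (\<forall>j\<in>{1..<k}. am j - am (j+1) \<ge> lam0 * T powr (1/2) \<and> ap j - ap (j+1) \<ge> lam0 * T powr (1/2))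
    \<and> am k - g l \<ge> lam1 * T \<and> ap k - g r \<ge> lam1 * T
    \<and> am 1 - g l \<le> b2 * T^2 \<and> ap 1 - g r \<le> b2 * T^2
    \<longrightarrow> cond_prob_H k l r am ap g P \<mu> lam0 lam1 T \<ge> (1 / C) * exp (- C * T powr (5/2))"
proof -
  \<comment> \<open>Deviations will be \<open>w0 * S\<close> with \<open>S = T powr (1/2)\<close>:
    two of them fit into the slack of the gaps and, as \<open>S \<le> T\<close>, one into the slack
    above \<open>g\<close>.\<close>
  define w0 where "w0 = (1 - \<mu>) / 2 * min lam0 lam1"
  \<comment> \<open>Independent of \<open>T\<close>: length at most \<open>b0 * T\<close> and energy
    at most \<open>\<kappa>\<close> give squared deviations at most
    \<open>2 * b0 * T * \<kappa>\<close>, hence at most \<open>w0\<^sup>2 * T\<close>. The bound by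
    \<open>1\<close> makes \<open>\<kappa> / (2 * real N + 2)\<close> at most one.\<close>
  define \<kappa> where "\<kappa> = min 1 (w0\<^sup>2 / (2 * b0))"
  \<comment> \<open>\<open>C1\<close> collects the coefficients of T^2 in the cost of the lift and
    of \<open>T * S\<close>, itself at most T^2, in the linear term.\<close>
  define C1 where "C1 = real k * (2 * real k * b1 * (lam0 + lam1) + 2 * (real k)\<^sup>2 * b1 * (lam0 + lam1)
    + (2 * b1 + 4 * real k * b1) * w0)"
  \<comment> \<open>Accounts for the share of mass at small energy, whose cost
    \<open>N * (2 * N + 2) / \<kappa>\<close> is at most \<open>C2\<close> times T^2 because
    \<open>N\<close> is at most \<open>k * b0 * T\<close>.\<close>
  define C2 where "C2 = real k * b0 * (2 * real k * b0 + 2) / \<kappa>"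
  \<comment> \<open>The summand \<open>2\<close> ensures that \<open>1 / C\<close> is at most the
    factor one half in the mass estimate.\<close>
  define C where "C = 2 + C1 + C2"
  have w0: "w0 > 0" "2 * w0 \<le> (1 - \<mu>) * lam0" "w0 \<le> (1 - \<mu>) * lam1"
  proof -
    have "(1 - \<mu>) * min lam0 lam1 \<le> (1 - \<mu>) * lam0" "(1 - \<mu>) * (min lam0 lam1 / 2) \<le> (1 - \<mu>) * lam1"
      using assms by (auto intro!: mult_left_mono)
    then show "w0 > 0" "2 * w0 \<le> (1 - \<mu>) * lam0" "w0 \<le> (1 - \<mu>) * lam1"
      using assms by (auto simp: w0_def)
  qed
  have \<kappa>: "\<kappa> > 0" "\<kappa> \<le> 1" "2 * b0 * \<kappa> \<le> w0\<^sup>2" using w0 assms by (auto simp: \<kappa>_def min_def field_simps)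
  have C12: "C1 \<ge> 0" "C2 \<ge> 0" using assms w0 \<kappa> by (auto simp: C1_def C2_def)
  then have C: "C \<ge> 2" by (simp add: C_def)
  show ?thesis
  proof (intro exI[of _ C] conjI allI impI)
    show "C > 0" using C by simp
    fix T l r :: real and am ap :: "nat \<Rightarrow> real" and g :: "real \<Rightarrow> real" and P :: "real set"
    assume *: "T \<ge> 10 \<and> l < r \<and> finite P \<and> P \<subseteq> {l<..<r}
      \<and> g l = 0 \<and> g r = 0
      \<and> r - l \<le> b0 * T \<and> real (card P) \<le> b0 * T
      \<and> (\<forall>x\<in>{l..r}. \<forall>y\<in>{l..r}. \<bar>g x - g y\<bar> \<le> b1 * T * \<bar>x - y\<bar>)
      \<and> (\<forall>j\<in>{1..<k}. am j - am (j+1) \<ge> lam0 * T powr (1/2) \<and> ap j - ap (j+1) \<ge> lam0 * T powr (1/2))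
      \<and> am k - g l \<ge> lam1 * T \<and> ap k - g r \<ge> lam1 * T
      \<and> am 1 - g l \<le> b2 * T^2 \<and> ap 1 - g r \<le> b2 * T^2"
    define S where "S = T powr (1/2)"
    have T: "T \<ge> 1" using * by simp
    have S: "S > 0" "S \<le> T" "S\<^sup>2 = T" "S \<ge> 0"
      using T powr_mono[of "1/2" 1 T] by (auto simp: S_def powr_half_sqrt)
    define N where "N = k * card P"
    have N: "real N \<le> real k * b0 * T" using * by (simp add: N_def mult.assoc mult_left_mono)
    let ?E = "real k * (2 * real k * (b1 * T) * ((lam0 + lam1) * T) + 2 * (real k)\<^sup>2 * (b1 * T) * ((lam0 + lam1) * T)
      + (2 * (b1 * T) + 4 * real k * (b1 * T)) * (w0 * S))"
    have "exp (- ?E) * (sqrt (\<kappa> / (2 * real N + 2)) ^ N / 2) \<le> cond_prob_H k l r am ap g P \<mu> lam0 lam1 T"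
      unfolding N_def
    proof (rule conditioned_bridges_lower_bound[where ?b0.0 = b0])
      show "2 * (b0 * T) * \<kappa> \<le> (w0 * S)\<^sup>2"
        using mult_right_mono[OF \<kappa>(3), of T] T by (simp add: power_mult_distrib S mult_ac)
      show "\<kappa> \<le> 2 * real (k * card P) + 2" using \<kappa>(2) of_nat_0_le_iff[of "k * card P"] by linarith
      show "2 * (w0 * S) \<le> (1 - \<mu>) * lam0 * T powr (1/2)"
        using mult_right_mono[OF w0(2) S(4)] by (simp add: S_def mult_ac)
      have "w0 * S \<le> w0 * T" using S w0 by simp
      also have "\<dots> \<le> (1 - \<mu>) * lam1 * T" using w0(3) T by (intro mult_right_mono) auto
      finally show "w0 * S \<le> (1 - \<mu>) * lam1 * T" .
    qed (use assms * T \<kappa> w0 S in auto)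
    moreover have "?E \<le> C1 * T\<^sup>2"
    proof -
      have "T * S \<le> T * T" using S T by simp
      then have "real k * (2 * b1 + 4 * real k * b1) * w0 * (T * S) \<le> real k * (2 * b1 + 4 * real k * b1) * w0 * (T * T)"
        using assms w0 S T by (intro mult_left_mono[of "T * S"]) auto
      then show ?thesis by (simp add: C1_def power2_eq_square algebra_simps)
    qed
    \<comment> \<open>The elementary inequalities
      \<open>exp (- (1 / x)) \<le> x \<le> sqrt x\<close> on the unit interval suffice: the exponent
      \<open>N / x\<close> is still of order T^2.\<close>
    moreover have "exp (- (C2 * T\<^sup>2)) \<le> sqrt (\<kappa> / (2 * real N + 2)) ^ N"
    proof -
      define x where "x = \<kappa> / (2 * real N + 2)"
      have x: "0 < x" "x \<le> 1" using \<kappa> by (auto simp: x_def field_simps)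
      have "exp (- (1 / x)) \<le> x"
        using exp_ge_add_one_self[of "1 / x"] x by (simp add: exp_minus field_simps)
      also have "x \<le> sqrt x" using x by (intro real_le_rsqrt) (simp add: power2_eq_square mult_left_le)
      finally have "exp (- (1 / x)) ^ N \<le> sqrt x ^ N" by (intro power_mono) auto
      moreover have "exp (- (1 / x)) ^ N = exp (- (real N * (1 / x)))" by (simp add: exp_of_nat_mult[symmetric])
      moreover have "real N * (1 / x) \<le> C2 * T\<^sup>2"
      proof -
        have "real N * (2 * real N + 2) \<le> (real k * b0 * T) * (2 * (real k * b0 * T) + 2 * T)"
          using N T by (intro mult_mono) auto
        then have "real N * (2 * real N + 2) / \<kappa> \<le> (real k * b0 * T) * (2 * (real k * b0 * T) + 2 * T) / \<kappa>"
          using \<kappa> by (intro divide_right_mono) auto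
        then show ?thesis by (simp add: x_def C2_def power2_eq_square algebra_simps)
      qed
      ultimately have "exp (- (C2 * T\<^sup>2)) \<le> sqrt x ^ N"
        using exp_le_cancel_iff[of "- (C2 * T\<^sup>2)" "- (real N * (1 / x))"] by linarith
      then show ?thesis by (simp only: x_def)
    qed
    ultimately have "exp (- (C1 * T\<^sup>2)) * (exp (- (C2 * T\<^sup>2)) / 2) \<le> cond_prob_H k l r am ap g P \<mu> lam0 lam1 T"
      by (elim order_trans[rotated]) (intro mult_mono divide_right_mono; simp)
    \<comment> \<open>The exponent of order T^2 is weakened to \<open>T powr (5/2)\<close>, using
      \<open>T \<ge> 1\<close>.\<close>
    moreover have "(1 / C) * exp (- C * T powr (5/2)) \<le> exp (- (C1 * T\<^sup>2)) * (exp (- (C2 * T\<^sup>2)) / 2)"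
    proof -
      have "T\<^sup>2 \<le> T powr (5/2)" using powr_mono[of 2 "5/2" T] T by simp
      then have "(C1 + C2) * T\<^sup>2 \<le> C * T powr (5/2)" using C12 by (intro mult_mono) (auto simp: C_def)
      then have "exp (- C * T powr (5/2)) \<le> exp (- ((C1 + C2) * T\<^sup>2))" by simp
      moreover have "1 / C \<le> 1 / 2" using C by (simp add: field_simps)
      ultimately have "(1 / C) * exp (- C * T powr (5/2)) \<le> 1 / 2 * exp (- ((C1 + C2) * T\<^sup>2))"
        by (intro mult_mono) auto
      also have "\<dots> = exp (- (C1 * T\<^sup>2)) * (exp (- (C2 * T\<^sup>2)) / 2)"
        by (simp add: exp_add[symmetric] algebra_simps)
      finally show ?thesis .
    qed
    ultimately show "cond_prob_H k l r am ap g P \<mu> lam0 lam1 T \<ge> (1 / C) * exp (- C * T powr (5/2))"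
      by linarith
  qed
qed

end
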